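(* Let $A\subset\mathbb{R}^2$ be a compact annulus bounded by two simple closed $C^1$ curves, let $X\in\mathbb{X}^1_\mu(A)$ be a non-vanishing vector field, and define $Z=X^\perp/\|X\|^2$. If $\operatorname{div}(Z)\neq 0$ at every point of $A$, then $X$ is robustly positive kinematic expansive.
   Context: $\mathbb{X}^1_\mu(A)$ denotes the vector space of $C^1$ vector fields $X$ defined on $A$ such that $\operatorname{div}(X)=0$ and, at the points of $\partial A$, $X$ is parallel (tangent) to $\partial A$. If $X=(a,b)$ then $X^\perp=(-b,a)$. A continuous flow $\phi$ on a compact metric space is positive kinematic expansive if for all $\epsilon>0$ there exists $\delta>0$ such that if $\operatorname{dist}(\phi_t(x),\phi_t(y))<\delta$ for all $t\ge 0$ then there exists $s\in\mathbb{R}$ such that $y=\phi_s(x)$ and $|s|<\epsilon$. A vector field $X\in\mathbb{X}^1_\mu(A)$ is robustly positive kinematic expansive if there is a $C^1$-neighborhood of $X$ in $\mathbb{X}^1_\mu(A)$ such that every vector field in this neighborhood generates a positive kinematic expansive flow on $A$. *)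

theory Defs
  imports "HOL-Analysis.Analysis"
begin

definition simple_closed_C1_curve :: "(real \<Rightarrow> real^2) \<Rightarrow> bool" where
  "simple_closed_C1_curve \<gamma> \<longleftrightarrow>
     simple_path \<gamma> \<and> pathfinish \<gamma> = pathstart \<gamma> \<and>
     (\<exists>\<gamma>'. (\<forall>t\<in>{0..1}. (\<gamma> has_vector_derivative \<gamma>' t) (at t within {0..1})) \<and>
           continuous_on {0..1} \<gamma>' \<and> \<gamma>' 0 = \<gamma>' 1 \<and> (\<forall>t\<in>{0..1}. \<gamma>' t \<noteq> 0))"

definition C1_annulus :: "(real^2) set \<Rightarrow> bool" where
  "C1_annulus A \<longleftrightarrow>
     (\<exists>\<alpha> \<beta>. simple_closed_C1_curve \<alpha> \<and> simple_closed_C1_curve \<beta> \<and>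
            path_image \<alpha> \<subseteq> inside (path_image \<beta>) \<and>
            A = (path_image \<beta> \<union> inside (path_image \<beta>)) - inside (path_image \<alpha>))"

text \<open>Vector fields on a set are total functions; their values off the set are irrelevant.
  As usual for sets with boundary, a map is of class \<open>C\<^sup>1\<close> on a set if it is the
  restriction of a \<open>C\<^sup>1\<close> map defined on an open neighbourhood of it.\<close>

definition C1_on :: "(real^2) set \<Rightarrow> (real^2 \<Rightarrow> real^2) \<Rightarrow> bool" where
  "C1_on A X \<longleftrightarrow>
     (\<exists>U F (F' :: real^2 \<Rightarrow> (real^2) \<Rightarrow>\<^sub>L (real^2)).
        open U \<and> A \<subseteq> U \<and> (\<forall>x\<in>A. F x = X x) \<and>
        (\<forall>x\<in>U. (F has_derivative blinfun_apply (F' x)) (at x)) \<and> continuous_on U F')"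

text \<open>The derivative is taken within the set, so that it is also available at boundary points
  and does not depend on an extension. It is unique at every point of an annulus
  with \<open>C\<^sup>1\<close> boundary.\<close>

definition divergence :: "(real^2) set \<Rightarrow> (real^2 \<Rightarrow> real^2) \<Rightarrow> real^2 \<Rightarrow> real" where
  "divergence A X x = (\<Sum>i\<in>UNIV. frechet_derivative X (at x within A) (axis i 1) $ i)"

definition tangent_vector :: "(real^2) set \<Rightarrow> real^2 \<Rightarrow> real^2 \<Rightarrow> bool" where
  "tangent_vector S p v \<longleftrightarrow>
     (\<exists>c e. e > 0 \<and> c 0 = p \<and> (\<forall>s\<in>{-e<..<e}. c s \<in> S) \<and> (c has_vector_derivative v) (at 0))"

definition C1_div_free_fields :: "(real^2) set \<Rightarrow> (real^2 \<Rightarrow> real^2) set" where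
  "C1_div_free_fields A =
     {X. C1_on A X \<and> (\<forall>x\<in>A. divergence A X x = 0) \<and>
         (\<forall>p\<in>frontier A. tangent_vector (frontier A) p (X p))}"

definition perp :: "real^2 \<Rightarrow> real^2" where
  "perp v = vector [- (v $ 2), v $ 1]"

definition continuous_flow_on :: "'a::metric_space set \<Rightarrow> (real \<Rightarrow> 'a \<Rightarrow> 'a) \<Rightarrow> bool" where
  "continuous_flow_on M \<phi> \<longleftrightarrow>
     continuous_on (UNIV \<times> M) (\<lambda>(t, x). \<phi> t x) \<and>
     (\<forall>t. \<forall>x\<in>M. \<phi> t x \<in> M) \<and>
     (\<forall>x\<in>M. \<phi> 0 x = x) \<and>
     (\<forall>s t. \<forall>x\<in>M. \<phi> (s + t) x = \<phi> s (\<phi> t x))"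

definition positive_kinematic_expansive ::
    "'a::metric_space set \<Rightarrow> (real \<Rightarrow> 'a \<Rightarrow> 'a) \<Rightarrow> bool" where
  "positive_kinematic_expansive M \<phi> \<longleftrightarrow>
     (\<forall>\<epsilon>>0. \<exists>\<delta>>0. \<forall>x\<in>M. \<forall>y\<in>M.
        (\<forall>t\<ge>0. dist (\<phi> t x) (\<phi> t y) < \<delta>) \<longrightarrow> (\<exists>s. y = \<phi> s x \<and> \<bar>s\<bar> < \<epsilon>))"

definition generates_flow ::
    "(real^2) set \<Rightarrow> (real^2 \<Rightarrow> real^2) \<Rightarrow> (real \<Rightarrow> real^2 \<Rightarrow> real^2) \<Rightarrow> bool" where
  "generates_flow A X \<phi> \<longleftrightarrow>
     continuous_flow_on A \<phi> \<and>
     (\<forall>x\<in>A. \<forall>t. ((\<lambda>t. \<phi> t x) has_vector_derivative X (\<phi> t x)) (at t))"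

definition C1_close ::
    "(real^2) set \<Rightarrow> real \<Rightarrow> (real^2 \<Rightarrow> real^2) \<Rightarrow> (real^2 \<Rightarrow> real^2) \<Rightarrow> bool" where
  "C1_close A e X Y \<longleftrightarrow>
     (\<forall>x\<in>A. norm (Y x - X x) < e \<and>
        onorm (\<lambda>v. frechet_derivative Y (at x within A) v
                    - frechet_derivative X (at x within A) v) < e)"

definition robustly_positive_kinematic_expansive ::
    "(real^2) set \<Rightarrow> (real^2 \<Rightarrow> real^2) \<Rightarrow> bool" where
  "robustly_positive_kinematic_expansive A X \<longleftrightarrow>
     (\<exists>e>0. \<forall>Y\<in>C1_div_free_fields A. C1_close A e X Y \<longrightarrow>
        (\<exists>\<phi>. generates_flow A Y \<phi> \<and> positive_kinematic_expansive A \<phi>))"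

end

theory Submission
  imports Defs
begin

text \<open>With \<open>N = X\<^sup>\<bottom> \<bullet> DX X + DX X\<^sup>\<bottom> \<bullet> X\<close> one has \<open>\<parallel>X\<parallel>\<^sup>4 div Z = - N\<close>, so the hypothesis says that \<open>N\<close>
  does not vanish. Since \<open>A\<close> is compact, every field that is \<open>C\<^sup>1\<close>-close to \<open>X\<close> has no zeros and satisfies
  the same condition, and it remains to show that such a field \<open>Y\<close> generates an expansive flow.
  If two orbits \<open>x\<close>, \<open>y\<close> stay close, let \<open>y (\<sigma> t)\<close> be the point of the second orbit on the
  normal line to \<open>Y\<close> at \<open>x t\<close>, and \<open>w t = y (\<sigma> t) - x t\<close>. The flux of \<open>Y\<close> through the segment from \<open>x t\<close> to
  \<open>y (\<sigma> t)\<close> is constant because \<open>Y\<close> is divergence-free, and comparable to \<open>\<parallel>w t\<parallel>\<close>. Differentiating the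
  orthogonality relation gives \<open>\<bar>\<sigma>' t - 1\<bar> \<ge> const \<parallel>w t\<parallel>\<close>, as \<open>N\<close> has no zeros. Since \<open>\<sigma> t - t\<close>
  is bounded, the flux must be zero, so \<open>w = 0\<close> and both points lie on the same orbit.\<close>

subsection \<open>Flows of Lipschitz fields tangent to the boundary\<close>


text \<open>The boundary shapes most of the work. Orbits might leave \<open>A\<close>, a derivative
  within \<open>A\<close> might be ambiguous at a boundary point, and the segment that carries the
  flux might stick out of the non-convex set \<open>A\<close>. An invariance argument excludes the
  first; the other two are excluded by one property of C1 curves, that short chords are nearly
  parallel to the tangent, so charts and collars are avoided. The quantity \<open>N\<close> comes
  from expanding the speed of \<sigma>: with v the value of \<open>Y\<close> at \<open>x t\<close>,
  \<sigma>' - 1 equals -(w . DY v + DY w . v) divided by the product of the field at the two ends,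
  up to an error dominated by this term; since w is a multiple of \<open>perp v\<close>, the bracket
  is a multiple of \<open>N\<close>. The conserved flux keeps this drift from fading: without it w
  could tend to 0 fast enough for \<sigma> t - t to stay bounded. With it, the mean value theorem
  over one long time interval suffices, whatever the sign of \<sigma>' - 1.\<close>

lemma norm_integral_exp_le:
  fixes h :: "real \<Rightarrow> 'a::euclidean_space"
  assumes K: "K > 0" and C: "C \<ge> 0" and h: "continuous_on {0..} h"
    and b: "\<And>s. s \<ge> 0 \<Longrightarrow> norm (h s) \<le> C * exp (K * s)"
  shows "norm (integral {0..t} h) \<le> C / K * exp (K * t)"
proof (cases "t \<ge> 0")
  case True
  have I: "((\<lambda>s. C * exp (K * s)) has_integral (C / K * exp (K * t) - C / K * exp (K * 0))) {0..t}"
    by (rule fundamental_theorem_of_calculus[OF True])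
      (use K in \<open>auto intro!: derivative_eq_intros simp flip: has_real_derivative_iff_has_vector_derivative\<close>)
  have "norm (integral {0..t} h) \<le> integral {0..t} (\<lambda>s. C * exp (K * s))"
    using I b by (intro integral_norm_bound_integral integrable_continuous_interval
        continuous_on_subset[OF h]) (auto intro!: continuous_intros)
  also have "\<dots> = C / K * exp (K * t) - C / K" using integral_unique[OF I] by simp
  also have "\<dots> \<le> C / K * exp (K * t)" using K C by simp
  finally show ?thesis .
qed (use K C in simp)

text \<open>For negative \<open>t\<close> the interval \<open>{0..t}\<close> is empty and the
  integral is 0, so the function is continued by a constant. The Picard operator can therefore act
  on bounded continuous functions on the whole line although only \<open>t \<ge> 0\<close>
  matters.\<close>

lemma continuous_on_integral_from_0:
  fixes h :: "real \<Rightarrow> 'a::euclidean_space"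
  assumes h: "continuous_on UNIV h"
  shows "continuous_on UNIV (\<lambda>t. integral {0..t} h)"
proof -
  have 1: "continuous_on {0..b} (\<lambda>t. integral {0..t} h)" for b
    by (intro indefinite_integral_continuous_1 integrable_continuous_interval continuous_on_subset[OF h]) auto
  have 2: "continuous_on {..b} (\<lambda>t. integral {0..t} h)" if "b > 0" for b :: real
  proof -
    have "{..b} = {..0} \<union> {0..b}" using that by auto
    moreover have "continuous_on {..0} (\<lambda>t. integral {0..t} h)"
      by (rule continuous_on_eq[OF continuous_on_const[of _ 0]]) (auto simp: le_less)
    ultimately show ?thesis using 1 by (metis continuous_on_closed_Un closed_atMost closed_atLeastAtMost)
  qed
  have "isCont (\<lambda>t. integral {0..t} h) t" for t :: real
    using 2[of "\<bar>t\<bar> + 1"] by (intro continuous_on_interior[where S="{..\<bar>t\<bar>+1}"]) auto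
  then show ?thesis by (simp add: continuous_on_eq_continuous_at)
qed

text \<open>Picard iteration in the norm weighted by \<open>exp (- K t)\<close>, which makes the integral
  operator a contraction on the whole half-line.\<close>

lemma lipschitz_ivp_forward:
  fixes G :: "'a::euclidean_space \<Rightarrow> 'a"
  assumes G: "L-lipschitz_on UNIV G"
  shows "\<exists>x. x 0 = x0 \<and> (\<forall>t\<ge>0. (x has_vector_derivative G (x t)) (at t within {0..}))"
proof -
  have L: "L \<ge> 0" using G by (simp add: lipschitz_on_def)
  have GL: "norm (G a - G b) \<le> L * norm (a - b)" for a b
    using G by (auto simp: lipschitz_on_def dist_norm)
  have Gc: "continuous_on UNIV G" using G by (rule lipschitz_on_continuous_on)
  \<comment> \<open>The weighted contraction factor will be \<open>L / K\<close>, hence at most 1/2;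
    the summand 1 keeps \<open>K\<close> positive when \<open>L = 0\<close>.\<close>
  define K where "K = 2 * L + 1"
  have K: "K > 0" using L by (simp add: K_def)
  \<comment> \<open>The unknown \<open>u\<close> stands for \<open>exp (- K * t)\<close> times the
    displacement from \<open>x0\<close>: it stays bounded even if the solution grows exponentially.
    \<open>f u\<close> is the field along the curve encoded by \<open>u\<close>.\<close>
  define f where "f u s = G (x0 + exp (K * s) *\<^sub>R apply_bcontfun u s)" for u :: "real \<Rightarrow>\<^sub>C 'a" and s
  have fc: "continuous_on UNIV (f u)" for u
    unfolding f_def by (intro continuous_on_compose2[OF Gc] continuous_intros) auto
  define S where "S u t = exp (- K * t) *\<^sub>R integral {0..t} (f u)" for u t
  have Sb: "S u \<in> bcontfun" for u
  proof -
    let ?C = "norm (G x0) + L * norm u"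
    have "norm (f u s) \<le> ?C * exp (K * s)" if "s \<ge> 0" for s
    proof -
      have e: "1 \<le> exp (K * s)" using that K by simp
      have "norm (f u s) \<le> norm (G x0) + norm (f u s - G x0)" by norm
      also have "\<dots> \<le> norm (G x0) + L * norm (exp (K * s) *\<^sub>R apply_bcontfun u s)"
        using GL[of "x0 + exp (K * s) *\<^sub>R apply_bcontfun u s" x0] by (simp add: f_def)
      also have "L * norm (exp (K * s) *\<^sub>R apply_bcontfun u s) \<le> L * (exp (K * s) * norm u)"
        using L by (intro mult_left_mono) (auto simp: norm_bounded)
      also have "norm (G x0) \<le> norm (G x0) * exp (K * s)"
        using mult_left_mono[OF e, of "norm (G x0)"] by simp
      finally show ?thesis by (simp add: algebra_simps)
    qed
    then have "norm (integral {0..t} (f u)) \<le> ?C / K * exp (K * t)" for t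
      using L K by (intro norm_integral_exp_le continuous_on_subset[OF fc]) auto
    then have "exp (- K * t) * norm (integral {0..t} (f u)) \<le> exp (- K * t) * (?C / K * exp (K * t))" for t
      by (intro mult_left_mono) auto
    moreover have "exp (- K * t) * (?C / K * exp (K * t)) = ?C / K" for t
      by (simp add: exp_minus)
    ultimately have "norm (S u t) \<le> ?C / K" for t
      by (simp only: S_def norm_scaleR abs_exp_cancel)
    moreover have "continuous_on UNIV (S u)"
      unfolding S_def by (intro continuous_intros continuous_on_integral_from_0 fc)
    ultimately show ?thesis unfolding bcontfun_def bounded_iff by blast
  qed
  define P where "P u = Bcontfun (S u)" for u
  have P: "apply_bcontfun (P u) = S u" for u
    unfolding P_def using Sb by (rule Bcontfun_inverse)
  have contr: "dist (P u) (P v) \<le> 1/2 * dist u v" for u v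
  proof (rule dist_bound)
    fix t
    have "norm (f u s - f v s) \<le> (L * dist u v) * exp (K * s)" for s
    proof -
      have "norm (f u s - f v s) \<le> L * norm (exp (K * s) *\<^sub>R (apply_bcontfun u s - apply_bcontfun v s))"
        using GL[of "x0 + exp (K * s) *\<^sub>R apply_bcontfun u s" "x0 + exp (K * s) *\<^sub>R apply_bcontfun v s"]
        by (simp add: f_def scaleR_diff_right)
      also have "\<dots> \<le> L * (exp (K * s) * dist u v)"
        using dist_bounded[of u s v] L by (intro mult_left_mono) (auto simp: dist_norm)
      finally show ?thesis by (simp add: mult_ac)
    qed
    then have "norm (integral {0..t} (\<lambda>s. f u s - f v s)) \<le> (L * dist u v) / K * exp (K * t)"
      using L K by (intro norm_integral_exp_le continuous_intros continuous_on_subset[OF fc]) auto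
    then have "exp (- K * t) * norm (integral {0..t} (\<lambda>s. f u s - f v s))
        \<le> exp (- K * t) * ((L * dist u v) / K * exp (K * t))"
      by (intro mult_left_mono) auto
    moreover have "integral {0..t} (\<lambda>s. f u s - f v s) = integral {0..t} (f u) - integral {0..t} (f v)"
      by (intro integral_diff integrable_continuous_interval continuous_on_subset[OF fc]) auto
    ultimately have "dist (S u t) (S v t) \<le> L / K * dist u v"
      by (simp add: S_def dist_norm flip: scaleR_diff_right) (simp add: exp_minus field_simps)
    also have "\<dots> \<le> 1/2 * dist u v"
      using L by (intro mult_right_mono) (auto simp: K_def field_simps)
    finally show "dist (apply_bcontfun (P u) t) (apply_bcontfun (P v) t) \<le> 1/2 * dist u v"
      by (simp add: P)
  qed
  obtain u where u: "P u = u"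
    using banach_fix_type[of "1/2" P] contr by auto
  define x where "x t = x0 + integral {0..t} (f u)" for t
  have xf: "f u t = G (x t)" for t
  proof -
    have "apply_bcontfun u t = S u t" using P[of u] u by simp
    then show ?thesis by (simp add: f_def x_def S_def exp_minus)
  qed
  have "(x has_vector_derivative G (x t)) (at t within {0..})" if "t \<ge> 0" for t
  proof -
    have "((\<lambda>t. integral {0..t} (f u)) has_vector_derivative f u t) (at t within {0..t+1})"
      using that by (intro integral_has_vector_derivative continuous_on_subset[OF fc]) auto
    then have "(x has_vector_derivative f u t) (at t within {0..t+1})"
      unfolding x_def by (auto intro!: derivative_eq_intros)
    moreover have "at t within {0..t+1} = at t within {0..}"
      by (rule at_within_nhd[of _ "{..<t+1}"]) auto
    ultimately show ?thesis by (simp add: xf)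
  qed
  moreover have "x 0 = x0" by (simp add: x_def)
  ultimately show ?thesis by blast
qed

text \<open>A forward solution for \<open>G\<close> and a time-reversed forward solution for
  \<open>- G\<close> are glued at 0, where both one-sided derivatives equal
  \<open>G x0\<close>.\<close>

lemma lipschitz_ivp:
  fixes G :: "'a::euclidean_space \<Rightarrow> 'a"
  assumes G: "L-lipschitz_on UNIV G"
  shows "\<exists>x. x 0 = x0 \<and> (\<forall>t. (x has_vector_derivative G (x t)) (at t))"
proof -
  have G': "L-lipschitz_on UNIV (\<lambda>v. - G v)"
    using G by (simp add: lipschitz_on_def dist_minus)
  obtain y where y: "y 0 = x0" "\<And>t. t \<ge> 0 \<Longrightarrow> (y has_vector_derivative G (y t)) (at t within {0..})"
    using lipschitz_ivp_forward[OF G] by blast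
  obtain z where z: "z 0 = x0" "\<And>t. t \<ge> 0 \<Longrightarrow> (z has_vector_derivative - G (z t)) (at t within {0..})"
    using lipschitz_ivp_forward[OF G'] by blast
  have z': "((\<lambda>t. z (- t)) has_vector_derivative G (z (- t))) (at t within {..0})" if "t \<le> 0" for t
  proof -
    have "uminus ` {..0} = {0::real..}" by simp
    then have "((z \<circ> uminus) has_vector_derivative - 1 *\<^sub>R - G (z (- t))) (at t within {..0})"
      using z(2)[of "- t"] that
      by (intro vector_diff_chain_within) (auto intro!: derivative_eq_intros)
    then show ?thesis by (simp add: o_def)
  qed
  define x where "x t = (if t \<in> {..0} then z (- t) else y t)" for t
  have "(x has_vector_derivative (if t \<in> {..0} then G (z (- t)) else G (y t))) (at t within UNIV)" for t
    unfolding x_def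
    by (rule has_vector_derivative_If_within_closures[where S="{..0}" and T="{0..}"])
      (use y z z' in \<open>auto simp: Un_commute\<close>)
  then have "\<forall>t. (x has_vector_derivative G (x t)) (at t)"
    by (metis (full_types) x_def)
  moreover have "x 0 = x0" by (simp add: x_def z)
  ultimately show ?thesis by blast
qed


section \<open>Extension of Lipschitz maps to the whole space\<close>

text \<open>McShane's formula: an infimum of the cones \<open>f a + L * dist x a\<close> is again
  \<open>L\<close>-Lipschitz, and at a point of \<open>A\<close> the cone with that apex attains
  it.\<close>

lemma lipschitz_extension_real:
  fixes f :: "'a::metric_space \<Rightarrow> real"
  assumes f: "L-lipschitz_on A f"
  shows "\<exists>g. L-lipschitz_on UNIV g \<and> (\<forall>x\<in>A. g x = f x)"
proof (cases "A = {}")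
  case True
  have "L-lipschitz_on UNIV (\<lambda>_::'a. 0::real)" using f by (simp add: lipschitz_on_def)
  with True show ?thesis by blast
next
  case False
  have L: "L \<ge> 0" using f by (simp add: lipschitz_on_def)
  define g where "g x = (INF a\<in>A. f a + L * dist x a)" for x
  have lower: "f b - L * dist x b \<le> f a + L * dist x a" if "a \<in> A" "b \<in> A" for x a b
  proof -
    have "f b - f a \<le> L * dist a b" using f that by (force simp: lipschitz_on_def dist_real_def dist_commute)
    also have "\<dots> \<le> L * (dist x a + dist x b)"
      using L by (intro mult_left_mono) (metis dist_commute dist_triangle, simp)
    finally show ?thesis by (simp add: algebra_simps)
  qed
  have bdd: "bdd_below ((\<lambda>a. f a + L * dist x a) ` A)" for x
    using False lower unfolding bdd_below_def by blast
  have le: "g x \<le> g y + L * dist x y" for x y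
  proof -
    have "g x - L * dist x y \<le> f a + L * dist y a" if "a \<in> A" for a
    proof -
      have "g x \<le> f a + L * dist x a" unfolding g_def using bdd that by (rule cINF_lower)
      moreover have "L * dist x a \<le> L * (dist x y + dist y a)"
        using L by (intro mult_left_mono dist_triangle)
      ultimately show ?thesis by (simp add: algebra_simps)
    qed
    then have "g x - L * dist x y \<le> g y"
      unfolding g_def[of y] by (rule cINF_greatest[OF False])
    then show ?thesis by simp
  qed
  have "L-lipschitz_on UNIV g"
  proof (rule lipschitz_onI[OF _ L])
    fix x y show "dist (g x) (g y) \<le> L * dist x y"
      using le[of x y] le[of y x] by (simp add: dist_real_def dist_commute abs_le_iff)
  qed
  moreover have "g x = f x" if "x \<in> A" for x
  proof (rule antisym)
    show "g x \<le> f x" unfolding g_def by (rule cINF_lower2[OF bdd that]) simp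
    show "f x \<le> g x" unfolding g_def
      using lower[OF _ that, of _ x] by (intro cINF_greatest[OF False]) simp
  qed
  ultimately show ?thesis by blast
qed

text \<open>McShane's extension is applied to each coordinate. The constant grows by the dimension,
  which is harmless since any global Lipschitz constant yields solutions for all time.\<close>

lemma lipschitz_extension_euclidean:
  fixes f :: "'a::metric_space \<Rightarrow> 'b::euclidean_space"
  assumes f: "L-lipschitz_on A f"
  shows "\<exists>g M. M-lipschitz_on UNIV g \<and> (\<forall>x\<in>A. g x = f x)"
proof -
  have L: "L \<ge> 0" using f by (simp add: lipschitz_on_def)
  have "\<exists>g. L-lipschitz_on UNIV g \<and> (\<forall>x\<in>A. g x = f x \<bullet> b)" if "b \<in> Basis" for b
  proof (rule lipschitz_extension_real, rule lipschitz_onI[OF _ L])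
    fix x y assume "x \<in> A" "y \<in> A"
    have "dist (f x \<bullet> b) (f y \<bullet> b) \<le> dist (f x) (f y)"
      using Basis_le_norm[OF that, of "f x - f y"] by (simp add: dist_norm inner_diff_left)
    also have "\<dots> \<le> L * dist x y" using f \<open>x \<in> A\<close> \<open>y \<in> A\<close> by (simp add: lipschitz_on_def)
    finally show "dist (f x \<bullet> b) (f y \<bullet> b) \<le> L * dist x y" .
  qed
  then obtain h where h: "\<And>b. b \<in> Basis \<Longrightarrow> L-lipschitz_on UNIV (h b)"
      "\<And>b x. b \<in> Basis \<Longrightarrow> x \<in> A \<Longrightarrow> h b x = f x \<bullet> b"
    by metis
  define g where "g x = (\<Sum>b\<in>Basis. h b x *\<^sub>R b)" for x
  have "(DIM('b) * L)-lipschitz_on UNIV g"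
  proof (rule lipschitz_onI)
    fix x y
    have "dist (g x) (g y) \<le> (\<Sum>b\<in>Basis. norm ((h b x - h b y) *\<^sub>R b))"
      unfolding g_def dist_norm scaleR_diff_left sum_subtractf[symmetric] by (rule norm_sum)
    also have "\<dots> \<le> (\<Sum>b\<in>(Basis::'b set). L * dist x y)"
    proof (rule sum_mono)
      fix b :: 'b assume b: "b \<in> Basis"
      show "norm ((h b x - h b y) *\<^sub>R b) \<le> L * dist x y"
        using h(1)[OF b] b by (simp add: lipschitz_on_def dist_real_def)
    qed
    finally show "dist (g x) (g y) \<le> DIM('b) * L * dist x y" by simp
  qed (use L in simp)
  moreover have "\<forall>x\<in>A. g x = f x"
    by (simp add: g_def h(2) euclidean_representation)
  ultimately show ?thesis by blast
qed

text \<open>Gronwall's bound in differential form: Cauchy-Schwarz and the Lipschitz condition make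
  \<open>exp (- 2 * L * t)\<close> times the squared distance nonincreasing.\<close>

lemma lipschitz_ivp_dist_le_forward:
  fixes G :: "'a::euclidean_space \<Rightarrow> 'a"
  assumes G: "L-lipschitz_on UNIV G"
    and x: "\<And>t. (x has_vector_derivative G (x t)) (at t)"
    and y: "\<And>t. (y has_vector_derivative G (y t)) (at t)"
    and t: "t \<ge> 0"
  shows "dist (x t) (y t) \<le> exp (L * t) * dist (x 0) (y 0)"
proof -
  have L: "L \<ge> 0" using G by (simp add: lipschitz_on_def)
  define w where "w t = x t - y t" for t
  have w: "(w has_vector_derivative G (x t) - G (y t)) (at t)" for t
    unfolding w_def by (intro derivative_intros x y)
  define g where "g t = exp (- 2 * L * t) * (w t \<bullet> w t)" for t
  have g: "(g has_real_derivative exp (- 2 * L * t) * (2 * (w t \<bullet> (G (x t) - G (y t))) - 2 * L * (w t \<bullet> w t))) (at t)" for t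
  proof -
    have "((\<lambda>t. w t \<bullet> w t) has_real_derivative 2 * (w t \<bullet> (G (x t) - G (y t)))) (at t)"
      using has_derivative_inner[OF w[of t, unfolded has_vector_derivative_def] w[of t, unfolded has_vector_derivative_def]]
      unfolding has_field_derivative_def
      by (rule has_derivative_eq_rhs) (simp add: fun_eq_iff inner_commute algebra_simps)
    then show ?thesis unfolding g_def
      by (auto intro!: derivative_eq_intros simp: algebra_simps)
  qed
  have "g t \<le> g 0"
  proof (rule DERIV_nonpos_imp_nonincreasing[OF t])
    fix s
    have "w s \<bullet> (G (x s) - G (y s)) \<le> norm (w s) * norm (G (x s) - G (y s))"
      by (rule norm_cauchy_schwarz)
    also have "\<dots> \<le> norm (w s) * (L * norm (w s))"
      using G by (intro mult_left_mono) (auto simp: lipschitz_on_def dist_norm w_def)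
    finally have "2 * (w s \<bullet> (G (x s) - G (y s))) - 2 * L * (w s \<bullet> w s) \<le> 0"
      by (simp add: dot_square_norm power2_eq_square mult_ac)
    then show "\<exists>d. (g has_real_derivative d) (at s) \<and> d \<le> 0"
      using g by (metis exp_ge_zero mult_nonneg_nonpos)
  qed
  then have "exp (- 2 * L * t) * (norm (w t))\<^sup>2 \<le> (norm (w 0))\<^sup>2"
    by (simp add: g_def dot_square_norm)
  then have "exp (2 * L * t) * (exp (- 2 * L * t) * (norm (w t))\<^sup>2) \<le> exp (2 * L * t) * (norm (w 0))\<^sup>2"
    by (rule mult_left_mono) simp
  moreover have "exp (2 * L * t) * (exp (- 2 * L * t) * (norm (w t))\<^sup>2) = (norm (w t))\<^sup>2"
    unfolding mult.assoc[symmetric] exp_add[symmetric] by simp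
  moreover have "exp (2 * L * t) * (norm (w 0))\<^sup>2 = (exp (L * t) * norm (w 0))\<^sup>2"
    by (simp add: power_mult_distrib mult.assoc flip: exp_double)
  ultimately have "(norm (w t))\<^sup>2 \<le> (exp (L * t) * norm (w 0))\<^sup>2"
    by (simp only:)
  then have "norm (w t) \<le> exp (L * t) * norm (w 0)"
    by (rule power2_le_imp_le) simp
  then show ?thesis by (simp add: w_def dist_norm)
qed

lemma has_vector_derivative_reflect:
  assumes "(x has_vector_derivative v) (at (- t))"
  shows "((\<lambda>t. x (- t)) has_vector_derivative - v) (at (t::real))"
proof -
  have "((x \<circ> uminus) has_vector_derivative - 1 *\<^sub>R v) (at t)"
    using assms by (intro vector_diff_chain_at) (auto intro!: derivative_eq_intros)
  then show ?thesis by (simp add: o_def)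
qed

lemma lipschitz_ivp_dist_le:
  fixes G :: "'a::euclidean_space \<Rightarrow> 'a"
  assumes G: "L-lipschitz_on UNIV G"
    and x: "\<And>t. (x has_vector_derivative G (x t)) (at t)"
    and y: "\<And>t. (y has_vector_derivative G (y t)) (at t)"
  shows "dist (x t) (y t) \<le> exp (L * \<bar>t\<bar>) * dist (x 0) (y 0)"
proof (cases "t \<ge> 0")
  case True
  then show ?thesis using lipschitz_ivp_dist_le_forward[OF G x y] by simp
next
  case False
  have "L-lipschitz_on UNIV (\<lambda>v. - G v)" using G by (simp add: lipschitz_on_def dist_minus)
  from lipschitz_ivp_dist_le_forward[OF this has_vector_derivative_reflect[OF x] has_vector_derivative_reflect[OF y], of "- t"]
  show ?thesis using False by simp
qed

section \<open>Invariance of a closed set under a tangent field\<close>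

text \<open>An interior point of \<open>A\<close> can be moved a little towards \<open>x\<close>
  without leaving \<open>A\<close>, which shortens the distance; so it is not nearest.\<close>

lemma nearest_point_in_frontier:
  fixes A :: "'a::real_normed_vector set"
  assumes "p \<in> A" "infdist x A = dist x p" "x \<notin> A"
  shows "p \<in> frontier A"
proof (rule ccontr)
  assume "p \<notin> frontier A"
  then have "p \<in> interior A" using assms(1) closure_subset by (auto simp: frontier_def)
  then obtain e where e: "e > 0" "ball p e \<subseteq> A" by (auto simp: mem_interior)
  have d: "dist x p > 0" using assms by auto
  define s where "s = min (1/2) (e / (2 * dist x p))"
  have s: "s > 0" "s < 1" "s * dist x p < e" using d e by (auto simp: s_def min_def field_simps)
  define q where "q = p + s *\<^sub>R (x - p)"
  have "dist p q = s * dist x p" using s by (simp add: q_def dist_norm)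
  then have "q \<in> A" using e s by auto
  then have "infdist x A \<le> dist x q" by (rule infdist_le)
  also have "x - q = (1 - s) *\<^sub>R (x - p)" by (simp add: q_def algebra_simps)
  then have "dist x q = (1 - s) * dist x p" using s by (simp add: dist_norm)
  also have "\<dots> < dist x p" using d s by simp
  finally show False using assms by simp
qed

text \<open>Nagumo's argument: the distance to \<open>A\<close> cannot overtake a function growing faster than
  \<open>exp (L t)\<close>, because at the nearest point the boundary curve and the solution separate
  with speed at most \<open>L\<close> times their distance.\<close>

lemma tangent_field_invariant_forward:
  fixes G :: "'a::euclidean_space \<Rightarrow> 'a"
  assumes A: "closed A" and G: "L-lipschitz_on UNIV G"
    and tangent: "\<And>p. p \<in> frontier A \<Longrightarrow>
      \<exists>c e. e > 0 \<and> c 0 = p \<and> (\<forall>s\<in>{-e<..<e}. c s \<in> A) \<and> (c has_vector_derivative G p) (at (0::real))"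
    and x: "\<And>t. (x has_vector_derivative G (x t)) (at t)"
    and x0: "x 0 \<in> A" and t: "t \<ge> 0"
  shows "x t \<in> A"
proof -
  have L: "L \<ge> 0" using G by (simp add: lipschitz_on_def)
  have ne: "A \<noteq> {}" using x0 by auto
  have xc: "continuous_on UNIV x"
    using x by (meson continuous_at_imp_continuous_on has_vector_derivative_continuous)
  define d where "d t = infdist (x t) A" for t
  have dc: "continuous_on S d" for S
    unfolding d_def by (intro continuous_on_infdist continuous_on_subset[OF xc]) auto
  have bound: "d t \<le> \<epsilon> * exp ((L + 1) * t)" if \<epsilon>: "\<epsilon> > 0" for \<epsilon>
  proof (rule ccontr)
    define g where "g t = \<epsilon> * exp ((L + 1) * t)" for t
    have gc: "continuous_on S g" for S unfolding g_def by (intro continuous_intros)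
    assume "\<not> d t \<le> \<epsilon> * exp ((L + 1) * t)"
    then have t1: "d t > g t" by (simp add: g_def)
    \<comment> \<open>The maximum \<open>t0\<close> of \<open>S\<close> is the last time at which
      the distance has not overtaken \<open>g\<close>; there the two are equal, and just afterwards
      the distance is larger.\<close>
    define S where "S = {s \<in> {0..t}. d s \<le> g s}"
    have "closed S" unfolding S_def
      by (intro continuous_on_closed_Collect_le dc gc closed_atLeastAtMost)
    then have S: "compact S"
      using bounded_subset[OF bounded_closed_interval[of 0 t], of S]
      unfolding compact_eq_bounded_closed by (auto simp: S_def subset_eq)
    have "d 0 = 0" using x0 by (simp add: d_def)
    then have "0 \<in> S" using t \<epsilon> by (simp add: S_def g_def)
    then obtain t0 where t0: "t0 \<in> S" "\<And>s. s \<in> S \<Longrightarrow> s \<le> t0"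
      using compact_attains_sup[OF S] by blast
    have t0t: "0 \<le> t0" "t0 < t" using t0(1) t1 by (auto simp: S_def le_less)
    have above: "d s > g s" if "t0 < s" "s \<le> t" for s
      using t0(2)[of s] that t0t by (force simp: S_def)
    have "d t0 = g t0"
    proof (rule antisym)
      show "d t0 \<le> g t0" using t0 by (simp add: S_def)
      have "((\<lambda>s. d s - g s) \<longlongrightarrow> d t0 - g t0) (at_right t0)"
        using continuous_on_diff[OF dc gc, of UNIV]
        by (simp add: continuous_on_eq_continuous_at continuous_within filterlim_at_split)
      moreover have "eventually (\<lambda>s. 0 \<le> d s - g s) (at_right t0)"
        unfolding eventually_at_right_field using above t0t by (intro exI[of _ t]) force
      ultimately have "0 \<le> d t0 - g t0" by (rule tendsto_lowerbound) simp
      then show "g t0 \<le> d t0" by simp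
    qed
    then have d0: "d t0 > 0" using \<epsilon> by (simp add: g_def)
    obtain p where p: "p \<in> A" "d t0 = dist (x t0) p"
      using infdist_attains_inf[OF A ne] unfolding d_def by metis
    have "x t0 \<notin> A" using d0 by (auto simp: d_def)
    then have "p \<in> frontier A" using p by (intro nearest_point_in_frontier) (auto simp: d_def)
    then obtain c e where c: "e > 0" "c 0 = p" "\<And>s. s \<in> {-e<..<e} \<Longrightarrow> c s \<in> A"
        "(c has_vector_derivative G p) (at (0::real))"
      using tangent by metis
    have "((\<lambda>s. x (t0 + s)) has_vector_derivative G (x t0)) (at 0)"
    proof -
      have "((x \<circ> (+) t0) has_vector_derivative 1 *\<^sub>R G (x t0)) (at 0)"
        using x[of t0] by (intro vector_diff_chain_at) (auto intro!: derivative_eq_intros)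
      then show ?thesis by (simp add: o_def)
    qed
    then have D: "((\<lambda>s. x (t0 + s) - c s) has_vector_derivative G (x t0) - G p) (at 0)"
      using c(4) by (rule has_vector_derivative_diff)
    \<comment> \<open>The tolerance \<open>d t0 / 2\<close> leaves room: together with the
      separation speed \<open>L * d t0\<close> it stays below \<open>(L + 1) * d t0\<close>, the
      growth rate of \<open>g\<close> at \<open>t0\<close>.\<close>
    then obtain r where r: "r > 0" "\<And>s. norm s < r \<Longrightarrow>
        norm ((x (t0 + s) - c s) - (x t0 - p) - s *\<^sub>R (G (x t0) - G p)) \<le> d t0 / 2 * norm s"
      using d0 c(2) unfolding has_vector_derivative_def has_derivative_at_alt
      by (metis (no_types, lifting) add.right_neutral diff_zero half_gt_zero)
    define s where "s = Min {e / 2, r / 2, t - t0}"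
    have s: "0 < s" "s < e" "s < r" "t0 + s \<le> t" using c(1) r(1) t0t by (auto simp: s_def min_def)
    have "d (t0 + s) \<le> dist (x (t0 + s)) (c s)"
      unfolding d_def using s by (intro infdist_le c(3)) auto
    also have "\<dots> \<le> norm (x t0 - p) + s * norm (G (x t0) - G p) + d t0 / 2 * s"
    proof -
      have "x (t0 + s) - c s = (x t0 - p) + s *\<^sub>R (G (x t0) - G p) +
          ((x (t0 + s) - c s) - (x t0 - p) - s *\<^sub>R (G (x t0) - G p))" by simp
      then have "dist (x (t0 + s)) (c s) \<le> norm (x t0 - p) + norm (s *\<^sub>R (G (x t0) - G p)) +
          norm ((x (t0 + s) - c s) - (x t0 - p) - s *\<^sub>R (G (x t0) - G p))"
        unfolding dist_norm by (metis norm_triangle_mono norm_triangle_ineq order_refl)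
      then show ?thesis using r(2)[of s] s by simp
    qed
    also have "\<dots> \<le> d t0 + s * (L * d t0) + d t0 / 2 * s"
      using G s p by (auto simp: lipschitz_on_def dist_norm intro!: mult_left_mono)
    also have "\<dots> < d t0 * (1 + (L + 1) * s)"
      using d0 s by (simp add: algebra_simps)
    also have "\<dots> \<le> d t0 * exp ((L + 1) * s)"
      using d0 by (intro mult_left_mono exp_ge_add_one_self) simp
    also have "\<dots> = g (t0 + s)"
      using \<open>d t0 = g t0\<close> by (simp add: g_def algebra_simps exp_add)
    finally show False using above[of "t0 + s"] s by simp
  qed
  have "d t \<le> 0"
  proof (rule field_le_epsilon)
    fix e :: real assume "e > 0"
    then have "d t \<le> e * (exp (- ((L + 1) * t)) * exp ((L + 1) * t))"
      using bound[of "e * exp (- ((L + 1) * t))"] by (simp add: mult.assoc)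
    then show "d t \<le> 0 + e" by (simp flip: exp_add)
  qed
  then have "infdist (x t) A = 0" using infdist_nonneg[of "x t" A] by (simp add: d_def)
  then show ?thesis using A ne by (simp add: in_closed_iff_infdist_zero)
qed

lemma tangent_field_invariant:
  fixes G :: "'a::euclidean_space \<Rightarrow> 'a"
  assumes A: "closed A" and G: "L-lipschitz_on UNIV G"
    and tangent: "\<And>p. p \<in> frontier A \<Longrightarrow>
      \<exists>c e. e > 0 \<and> c 0 = p \<and> (\<forall>s\<in>{-e<..<e}. c s \<in> A) \<and> (c has_vector_derivative G p) (at (0::real))"
    and x: "\<And>t. (x has_vector_derivative G (x t)) (at t)"
    and x0: "x 0 \<in> A"
  shows "x t \<in> A"
proof (cases "t \<ge> 0")
  case True
  show ?thesis by (rule tangent_field_invariant_forward[OF A G tangent x x0 True])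
next
  case False
  have G': "L-lipschitz_on UNIV (\<lambda>v. - G v)" using G by (simp add: lipschitz_on_def dist_minus)
  have tangent': "\<exists>c e. e > 0 \<and> c 0 = p \<and> (\<forall>s\<in>{-e<..<e}. c s \<in> A) \<and>
      (c has_vector_derivative - G p) (at (0::real))" if p: "p \<in> frontier A" for p
  proof -
    obtain c e where c: "e > 0" "c 0 = p" "\<And>s. s \<in> {-e<..<e} \<Longrightarrow> c s \<in> A"
        "(c has_vector_derivative G p) (at (0::real))"
      using tangent[OF p] by metis
    have "((\<lambda>s. c (- s)) has_vector_derivative - G p) (at 0)"
      using c(4) by (intro has_vector_derivative_reflect) simp
    then show ?thesis using c(1,2,3) by (intro exI[of _ "\<lambda>s. c (- s)"] exI[of _ e]) auto
  qed
  have "(\<lambda>t. x (- t)) (- t) \<in> A"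
    by (rule tangent_field_invariant_forward[OF A G' tangent' has_vector_derivative_reflect[OF x]])
      (use x0 False in auto)
  then show ?thesis by simp
qed

text \<open>The field is extended to a Lipschitz field on the plane, whose solutions are global;
  invariance of \<open>A\<close> makes the choice of the extension immaterial. The exponential
  distance bound serves twice: for equal initial points it is uniqueness, hence the group law, and
  in general it gives continuity in the initial point.\<close>

lemma lipschitz_tangent_field_generates_flow:
  fixes Y :: "real^2 \<Rightarrow> real^2"
  assumes A: "closed A" and Y: "L-lipschitz_on A Y"
    and tangent: "\<And>p. p \<in> frontier A \<Longrightarrow> tangent_vector (frontier A) p (Y p)"
  shows "\<exists>\<phi>. generates_flow A Y \<phi>"
proof -
  obtain G M where G: "M-lipschitz_on UNIV G" and GY: "\<And>x. x \<in> A \<Longrightarrow> G x = Y x"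
    using lipschitz_extension_euclidean[OF Y] by blast
  have fA: "frontier A \<subseteq> A" using A by (rule frontier_subset_closed)
  have tan: "\<exists>c e. e > 0 \<and> c 0 = p \<and> (\<forall>s\<in>{-e<..<e}. c s \<in> A) \<and>
      (c has_vector_derivative G p) (at (0::real))" if "p \<in> frontier A" for p
    using tangent[OF that] fA GY[of p] that unfolding tangent_vector_def by (metis subsetD)
  obtain \<Phi> where \<Phi>: "\<And>x. \<Phi> x 0 = x" "\<And>x t. (\<Phi> x has_vector_derivative G (\<Phi> x t)) (at t)"
    using lipschitz_ivp[OF G] by metis
  have inv: "\<Phi> x t \<in> A" if "x \<in> A" for x t
    by (rule tangent_field_invariant[OF A G tan \<Phi>(2)]) (use that \<Phi>(1) in auto)
  have dist: "dist (\<Phi> x t) (\<Phi> y t) \<le> exp (M * \<bar>t\<bar>) * dist x y" for x y t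
    using lipschitz_ivp_dist_le[OF G \<Phi>(2)[of x] \<Phi>(2)[of y], of t] by (simp add: \<Phi>(1))
  define \<phi> where "\<phi> t x = \<Phi> x t" for t x
  have group: "\<phi> (s + t) x = \<phi> s (\<phi> t x)" for s t x
  proof -
    have "((\<lambda>s. \<Phi> x (s + t)) has_vector_derivative G (\<Phi> x (s + t))) (at s)" for s
    proof -
      have "((\<Phi> x \<circ> (\<lambda>s. s + t)) has_vector_derivative 1 *\<^sub>R G (\<Phi> x (s + t))) (at s)"
        using \<Phi>(2)[of x "s + t"] by (intro vector_diff_chain_at) (auto intro!: derivative_eq_intros)
      then show ?thesis by (simp add: o_def)
    qed
    from lipschitz_ivp_dist_le[OF G this \<Phi>(2)[of "\<Phi> x t"], of s]
    show ?thesis by (simp add: \<phi>_def \<Phi>(1))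
  qed
  have cont: "continuous (at (t, x)) (\<lambda>(t, x). \<phi> t x)" for t x
  proof -
    have \<Phi>c: "isCont (\<Phi> x) t" for x t
      using \<Phi>(2) by (rule has_vector_derivative_continuous)
    have lim: "((\<lambda>p. fst p) \<longlongrightarrow> t) (at (t, x))" "((\<lambda>p. snd p) \<longlongrightarrow> x) (at (t, x))"
      using tendsto_fst[OF tendsto_ident_at, of "(t, x)" UNIV] tendsto_snd[OF tendsto_ident_at, of "(t, x)" UNIV] by simp_all
    have "((\<lambda>p. exp (M * \<bar>fst p\<bar>) * dist (snd p) x + dist (\<Phi> x (fst p)) (\<Phi> x t)) \<longlongrightarrow>
        exp (M * \<bar>t\<bar>) * dist x x + dist (\<Phi> x t) (\<Phi> x t)) (at (t, x))"
      by (intro tendsto_intros isCont_tendsto_compose[OF \<Phi>c] lim)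
    then have 0: "((\<lambda>p. exp (M * \<bar>fst p\<bar>) * dist (snd p) x + dist (\<Phi> x (fst p)) (\<Phi> x t)) \<longlongrightarrow> 0) (at (t, x))"
      by simp
    have "dist (\<phi> s z) (\<phi> t x) \<le> exp (M * \<bar>s\<bar>) * dist z x + dist (\<Phi> x s) (\<Phi> x t)" for s z
      unfolding \<phi>_def by (rule order_trans[OF dist_triangle[of _ _ "\<Phi> x s"] add_right_mono[OF dist]])
    then have "\<forall>\<^sub>F p in at (t, x). norm (dist (\<phi> (fst p) (snd p)) (\<phi> t x))
        \<le> exp (M * \<bar>fst p\<bar>) * dist (snd p) x + dist (\<Phi> x (fst p)) (\<Phi> x t)"
      by (intro always_eventually) simp
    then have "((\<lambda>p. dist (\<phi> (fst p) (snd p)) (\<phi> t x)) \<longlongrightarrow> 0) (at (t, x))"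
      using 0 by (rule Lim_null_comparison)
    then have "((\<lambda>p. \<phi> (fst p) (snd p)) \<longlongrightarrow> \<phi> t x) (at (t, x))"
      by (rule tendsto_dist_iff[THEN iffD2])
    then show ?thesis unfolding continuous_within by (simp add: case_prod_unfold)
  qed
  have "continuous_flow_on A \<phi>"
    unfolding continuous_flow_on_def
  proof (intro conjI allI ballI)
    show "continuous_on (UNIV \<times> A) (\<lambda>(t, x). \<phi> t x)"
      using cont by (auto intro!: continuous_at_imp_continuous_on)
  qed (use inv \<Phi>(1) group in \<open>auto simp: \<phi>_def\<close>)
  moreover have "((\<lambda>t. \<phi> t x) has_vector_derivative Y (\<phi> t x)) (at t)" if "x \<in> A" for x t
    using \<Phi>(2)[of x t] GY[OF inv[OF that]] by (simp add: \<phi>_def)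
  ultimately show ?thesis unfolding generates_flow_def by blast
qed

subsection \<open>The boundary of the annulus\<close>


lemma perp_nth [simp]: "perp v $ 1 = - (v $ 2)" "perp v $ 2 = v $ 1"
  by (simp_all add: perp_def)

lemma inner_2: "v \<bullet> w = v $ 1 * w $ 1 + v $ 2 * w $ 2" for v w :: "real^2"
  by (simp add: inner_vec_def sum_2)

lemma bounded_linear_perp: "bounded_linear perp"
proof -
  have "linear perp" by (rule linearI) (simp_all add: vec_eq_iff forall_2)
  then show ?thesis by (rule linear_conv_bounded_linear[THEN iffD1])
qed

lemmas perp_diff = linear_diff[OF bounded_linear.linear[OF bounded_linear_perp]]
  and perp_scaleR = linear_scale[OF bounded_linear.linear[OF bounded_linear_perp]]

lemma inner_perp_self [simp]: "v \<bullet> perp v = 0" "perp v \<bullet> v = 0"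
  by (simp_all add: inner_2)

lemma norm_perp [simp]: "norm (perp v) = norm v"
  by (simp add: norm_eq_sqrt_inner inner_2)

text \<open>Expansion in the orthogonal basis \<open>v\<close>, \<open>perp v\<close>, multiplied by
  the squared length of \<open>v\<close> so that \<open>v = 0\<close> is allowed.\<close>

lemma perp_decomposition: "(v \<bullet> v) *\<^sub>R w = (w \<bullet> v) *\<^sub>R v + (w \<bullet> perp v) *\<^sub>R perp v"
  by (simp add: vec_eq_iff forall_2 inner_2 algebra_simps)

lemma norm_mult_norm_perp: "(norm v * norm w)\<^sup>2 = (w \<bullet> v)\<^sup>2 + (w \<bullet> perp v)\<^sup>2"
  unfolding power_mult_distrib power2_norm_eq_inner
  by (simp add: inner_2 power2_eq_square algebra_simps)

lemma abs_inner_perp_eq: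
  assumes "w \<bullet> v = 0"
  shows "\<bar>w \<bullet> perp v\<bar> = norm v * norm w"
proof (rule power2_eq_imp_eq)
  show "\<bar>w \<bullet> perp v\<bar>\<^sup>2 = (norm v * norm w)\<^sup>2" using norm_mult_norm_perp[of v w] assms by simp
qed simp_all

lemma orthogonal_perp:
  assumes "w \<bullet> perp v = 0" "v \<noteq> 0"
  shows "w = ((w \<bullet> v) / (v \<bullet> v)) *\<^sub>R v"
proof -
  have "(v \<bullet> v) *\<^sub>R w = (w \<bullet> v) *\<^sub>R v" using perp_decomposition[of v w] assms by simp
  then have "(1 / (v \<bullet> v)) *\<^sub>R ((v \<bullet> v) *\<^sub>R w) = (1 / (v \<bullet> v)) *\<^sub>R ((w \<bullet> v) *\<^sub>R v)" by simp
  then show ?thesis using assms by simp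
qed

text \<open>Near \<open>p\<close>, all chords of \<open>S\<close> are nearly parallel to \<open>v\<close>. This is the only regularity of the
  boundary that is needed; in particular a transversal line meets \<open>S\<close> at most once near \<open>p\<close>.\<close>

definition chords_parallel_at :: "(real^2) set \<Rightarrow> real^2 \<Rightarrow> real^2 \<Rightarrow> bool" where
  "chords_parallel_at S p v \<longleftrightarrow> v \<noteq> 0 \<and>
     (\<forall>\<eta>>0. \<exists>r>0. \<forall>q\<in>S \<inter> ball p r. \<forall>q'\<in>S \<inter> ball p r. \<bar>(q - q') \<bullet> perp v\<bar> \<le> \<eta> * norm (q - q'))"

lemma chords_parallel_at_subset:
  assumes "chords_parallel_at S p v" "r > 0" "T \<inter> ball p r \<subseteq> S"
  shows "chords_parallel_at T p v"
  unfolding chords_parallel_at_def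
proof (intro conjI allI impI)
  show "v \<noteq> 0" using assms by (simp add: chords_parallel_at_def)
  fix \<eta> :: real assume "\<eta> > 0"
  then obtain r' where r': "r' > 0" "\<forall>q\<in>S \<inter> ball p r'. \<forall>q'\<in>S \<inter> ball p r'. \<bar>(q - q') \<bullet> perp v\<bar> \<le> \<eta> * norm (q - q')"
    using assms(1) unfolding chords_parallel_at_def by meson
  then show "\<exists>r>0. \<forall>q\<in>T \<inter> ball p r. \<forall>q'\<in>T \<inter> ball p r. \<bar>(q - q') \<bullet> perp v\<bar> \<le> \<eta> * norm (q - q')"
  proof (intro exI[of _ "min r r'"] conjI ballI)
    fix q q' assume "q \<in> T \<inter> ball p (min r r')" "q' \<in> T \<inter> ball p (min r r')"
    then have "q \<in> S \<inter> ball p r'" "q' \<in> S \<inter> ball p r'" using assms(3) by auto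
    with r' show "\<bar>(q - q') \<bullet> perp v\<bar> \<le> \<eta> * norm (q - q')" by blast
  qed (use assms(2) r' in auto)
qed

text \<open>Near \<open>t0\<close> the map \<open>t \<mapsto> g t - t *\<^sub>R v\<close> has small
  derivative, so the mean value inequality makes each chord almost
  \<open>(s - s') *\<^sub>R v\<close>. The assumption on \<open>S\<close> keeps other strands of the
  set away from \<open>g t0\<close>, so that nearby points of \<open>S\<close> have nearby
  parameters.\<close>

lemma chords_parallel_at_curve:
  fixes g g' :: "real \<Rightarrow> real^2"
  assumes t0: "t0 \<in> {a<..<b}"
    and g: "\<And>t. t \<in> {a<..<b} \<Longrightarrow> (g has_vector_derivative g' t) (at t)"
    and g': "continuous_on {a<..<b} g'" "g' t0 \<noteq> 0"
    and S: "\<And>\<tau>. \<tau> > 0 \<Longrightarrow> \<exists>r>0. S \<inter> ball (g t0) r \<subseteq> g ` ball t0 \<tau>"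
  shows "chords_parallel_at S (g t0) (g' t0)"
  unfolding chords_parallel_at_def
proof (intro conjI allI impI)
  show "g' t0 \<noteq> 0" by fact
  fix \<eta> :: real assume \<eta>: "\<eta> > 0"
  define v where "v = g' t0"
  \<comment> \<open>A parameter difference s gives a chord of length at least (|v| - \<epsilon>)|s|
    with deviation at most \<epsilon>|v||s| along \<open>perp v\<close>; the choice makes the ratio
    at most \<eta>.\<close>
  define \<epsilon> where "\<epsilon> = min (norm v / 2) (\<eta> / 2)"
  have \<epsilon>: "\<epsilon> > 0" "\<epsilon> * norm v \<le> \<eta> * (norm v - \<epsilon>)"
  proof -
    show "\<epsilon> > 0" using \<eta> g'(2) by (simp add: \<epsilon>_def v_def)
    have "\<epsilon> * norm v \<le> \<eta> / 2 * norm v" by (intro mult_right_mono) (auto simp: \<epsilon>_def)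
    also have "\<dots> = \<eta> * (norm v / 2)" by simp
    also have "\<dots> \<le> \<eta> * (norm v - \<epsilon>)" using \<eta> by (intro mult_left_mono) (auto simp: \<epsilon>_def)
    finally show "\<epsilon> * norm v \<le> \<eta> * (norm v - \<epsilon>)" .
  qed
  have "isCont g' t0" using g'(1) t0 by (simp add: continuous_on_eq_continuous_at)
  then obtain d where d: "d > 0" "\<And>t. dist t t0 < d \<Longrightarrow> dist (g' t) v < \<epsilon>"
    using \<epsilon>(1) unfolding continuous_at_eps_delta v_def by metis
  define \<tau> where "\<tau> = Min {d, t0 - a, b - t0}"
  have \<tau>: "\<tau> > 0" "\<tau> \<le> d" "\<tau> \<le> t0 - a" "\<tau> \<le> b - t0" using d t0 by (auto simp: \<tau>_def)
  have sub: "ball t0 \<tau> \<subseteq> {a<..<b}" using \<tau> by (auto simp: dist_real_def)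
  obtain r where r: "r > 0" "S \<inter> ball (g t0) r \<subseteq> g ` ball t0 \<tau>" using S[OF \<tau>(1)] by blast
  have "\<bar>(g s - g s') \<bullet> perp v\<bar> \<le> \<eta> * norm (g s - g s')" if s: "s \<in> ball t0 \<tau>" "s' \<in> ball t0 \<tau>" for s s'
  proof -
    define h where "h t = g t - t *\<^sub>R v" for t
    have "norm (h s - h s') \<le> \<epsilon> * norm (s - s')"
    proof (rule differentiable_bound[where S="ball t0 \<tau>" and f'="\<lambda>t z. z *\<^sub>R (g' t - v)"])
      fix t assume t: "t \<in> ball t0 \<tau>"
      have "(h has_vector_derivative g' t - v) (at t)"
        unfolding h_def using g[of t] t sub by (auto intro!: derivative_eq_intros)
      then show "(h has_derivative (\<lambda>z. z *\<^sub>R (g' t - v))) (at t within ball t0 \<tau>)"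
        unfolding has_vector_derivative_def by (rule has_derivative_at_withinI)
      have "dist t t0 < d" using t \<tau> by (simp add: dist_commute)
      then have "norm (g' t - v) \<le> \<epsilon>" using d(2)[of t] by (simp add: dist_norm)
      then show "onorm (\<lambda>z. z *\<^sub>R (g' t - v)) \<le> \<epsilon>"
        using mult_right_mono[OF _ abs_ge_zero, of "norm (g' t - v)" \<epsilon>]
        by (intro onorm_le) (simp add: mult.commute)
    qed (use s in auto)
    then have e: "norm (g s - g s' - (s - s') *\<^sub>R v) \<le> \<epsilon> * \<bar>s - s'\<bar>"
      by (simp add: h_def algebra_simps)
    have "(g s - g s') \<bullet> perp v = (g s - g s' - (s - s') *\<^sub>R v) \<bullet> perp v"
      by (simp add: inner_diff_left)
    also have "\<bar>\<dots>\<bar> \<le> norm (g s - g s' - (s - s') *\<^sub>R v) * norm v"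
      using Cauchy_Schwarz_ineq2[of "g s - g s' - (s - s') *\<^sub>R v" "perp v"] by simp
    also have "\<dots> \<le> \<epsilon> * \<bar>s - s'\<bar> * norm v" using e by (intro mult_right_mono) auto
    also have "\<dots> = \<epsilon> * norm v * \<bar>s - s'\<bar>" by simp
    also have "\<dots> \<le> \<eta> * (norm v - \<epsilon>) * \<bar>s - s'\<bar>" using \<epsilon>(2) by (intro mult_right_mono) auto
    also have "\<dots> = \<eta> * (norm ((s - s') *\<^sub>R v) - \<epsilon> * \<bar>s - s'\<bar>)"
      unfolding norm_scaleR by (simp add: algebra_simps)
    also have "\<dots> \<le> \<eta> * norm (g s - g s')"
      using e \<eta> norm_triangle_ineq2[of "(s - s') *\<^sub>R v" "g s - g s'"]
      by (intro mult_left_mono) (auto simp: norm_minus_commute)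
    finally show ?thesis .
  qed
  with r show "\<exists>r>0. \<forall>q\<in>S \<inter> ball (g t0) r. \<forall>q'\<in>S \<inter> ball (g t0) r. \<bar>(q - q') \<bullet> perp (g' t0)\<bar> \<le> \<eta> * norm (q - q')"
    unfolding v_def by (intro exI[of _ r]) blast
qed

text \<open>Injectivity of the loop and compactness of the remaining parameters keep the rest of the
  curve at a positive distance from \<open>p\<close>, so only parameters near that of
  \<open>p\<close> count.\<close>

lemma simple_closed_C1_curve_chords_parallel:
  assumes "simple_closed_C1_curve \<gamma>" "p \<in> path_image \<gamma>"
  shows "\<exists>v. chords_parallel_at (path_image \<gamma>) p v"
proof -
  obtain \<gamma>' where \<gamma>: "simple_path \<gamma>" "\<gamma> 1 = \<gamma> 0"
      "\<And>t. t \<in> {0..1} \<Longrightarrow> (\<gamma> has_vector_derivative \<gamma>' t) (at t within {0..1})"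
      "continuous_on {0..1} \<gamma>'" "\<gamma>' 0 = \<gamma>' 1" "\<And>t. t \<in> {0..1} \<Longrightarrow> \<gamma>' t \<noteq> 0"
    using assms(1) unfolding simple_closed_C1_curve_def pathfinish_def pathstart_def by blast
  have \<gamma>c: "continuous_on {0..1} \<gamma>" using \<gamma>(1) by (simp add: simple_path_def path_def)
  obtain t0 where t0: "0 \<le> t0" "t0 < 1" "p = \<gamma> t0"
  proof -
    obtain t where "t \<in> {0..1}" "p = \<gamma> t" using assms(2) by (auto simp: path_image_def)
    then show thesis using that[of t] that[of 0] \<gamma>(2) by (cases "t = 1") auto
  qed
  \<comment> \<open>The loop is prolonged periodically to \<open>{-1..1}\<close>, so that the
    parameter 0 becomes interior too; the matching end derivatives of \<gamma> make the prolongation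
    C1 there.\<close>
  define g where "g t = (if t \<in> {-1..0} then \<gamma> (t + 1) else \<gamma> t)" for t
  define g' where "g' t = (if t \<in> {-1..0} then \<gamma>' (t + 1) else \<gamma>' t)" for t
  have g_pos: "g t = \<gamma> t" if "t \<ge> 0" for t using that \<gamma>(2) by (cases "t = 0") (auto simp: g_def)
  have Un: "{-1..1} = {-1..0} \<union> {0..1::real}" by auto
  have shift: "((\<lambda>t. \<gamma> (t + 1)) has_vector_derivative \<gamma>' (t + 1)) (at t within {-1..0})"
    if "t \<in> {-1..0}" for t
  proof -
    have im: "(\<lambda>t. t + 1) ` {-1..0} = {0::real..1}"
      using image_add_atLeastAtMost'[of 1 "-1" 0] by simp
    have "((\<gamma> \<circ> (\<lambda>t. t + 1)) has_vector_derivative 1 *\<^sub>R \<gamma>' (t + 1)) (at t within {-1..0})"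
      using \<gamma>(3)[of "t + 1"] that im
      by (intro vector_diff_chain_within) (auto intro!: derivative_eq_intros)
    then show ?thesis by (simp add: o_def)
  qed
  have cls: "{-1..0} \<union> (closure {-1..0} \<inter> closure {0..1}) = {-1..0::real}"
    "{0..1} \<union> (closure {-1..0} \<inter> closure {0..1}) = {0..1::real}" by auto
  have "(g has_vector_derivative g' t) (at t within {-1..1})" if "t \<in> {-1..1}" for t
    unfolding g_def g'_def
    by (rule has_vector_derivative_If_within_closures[where S="{-1..0}" and T="{0..1}", unfolded cls])
      (use that \<gamma> shift in auto)
  then have gd: "(g has_vector_derivative g' t) (at t)" if "t \<in> {-1<..<1}" for t
    using that by (metis at_within_Icc_at greaterThanLessThan_iff atLeastAtMost_iff less_imp_le)
  have "continuous_on {-1..1} g'"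
  proof -
    have "continuous_on ({-1..0} \<union> {0..1}) g'" unfolding g'_def
      by (rule continuous_on_If) (auto intro!: continuous_on_compose2[OF \<gamma>(4)] continuous_intros \<gamma>(4) simp: \<gamma>(5) Un_absorb2)
    then show ?thesis by (simp add: Un)
  qed
  then have g'c: "continuous_on {-1<..<1} g'" by (rule continuous_on_subset) auto
  have "g' t0 = \<gamma>' t0" using t0 \<gamma>(5) by (cases "t0 = 0") (auto simp: g'_def)
  then have g'0: "g' t0 \<noteq> 0" using \<gamma>(6) t0 by simp
  have "\<exists>r>0. path_image \<gamma> \<inter> ball (g t0) r \<subseteq> g ` ball t0 \<tau>" if \<tau>: "\<tau> > 0" for \<tau>
  proof -
    define \<sigma> where "\<sigma> = min \<tau> (1 - t0)"
    have \<sigma>: "\<sigma> > 0" "\<sigma> \<le> \<tau>" "\<sigma> \<le> 1 - t0" using \<tau> t0 by (auto simp: \<sigma>_def)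
    \<comment> \<open>The parameters at distance at least \<sigma> from both \<open>t0\<close> and
      \<open>t0 + 1\<close>, the two representatives of the same point of the circle.\<close>
    define K where "K = {s \<in> {0..1}. \<sigma> \<le> \<bar>s - t0\<bar> \<and> \<sigma> \<le> \<bar>s - 1 - t0\<bar>}"
    have "closed K" unfolding K_def
      by (intro closed_Collect_conj closed_Collect_le continuous_intros closed_atLeastAtMost)
        (simp only: Collect_mem_eq closed_atLeastAtMost)
    then have "compact K"
      unfolding compact_eq_bounded_closed
      by (auto intro!: bounded_subset[OF bounded_closed_interval[of 0 1]] simp: K_def)
    then have "compact (\<gamma> ` K)"
      by (intro compact_continuous_image continuous_on_subset[OF \<gamma>c]) (auto simp: K_def)
    then have cl: "closed (\<gamma> ` K)" by (rule compact_imp_closed)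
    have "g t0 \<notin> \<gamma> ` K"
    proof
      assume "g t0 \<in> \<gamma> ` K"
      then obtain s where s: "s \<in> K" "\<gamma> s = \<gamma> t0" using g_pos[OF t0(1)] by (metis imageE)
      then have "s = t0 \<or> (s = 0 \<and> t0 = 1) \<or> (s = 1 \<and> t0 = 0)"
        using \<gamma>(1) t0 unfolding simple_path_def loop_free_def K_def by force
      then show False using s(1) \<sigma>(1) t0 by (auto simp: K_def)
    qed
    then obtain r where r: "r > 0" "ball (g t0) r \<inter> \<gamma> ` K = {}"
      using cl by (metis Int_commute disjoint_eq_subset_Compl open_Compl open_contains_ball ComplI)
    have "q \<in> g ` ball t0 \<tau>" if q: "q \<in> path_image \<gamma>" "q \<in> ball (g t0) r" for q
    proof -
      obtain s where s: "s \<in> {0..1}" "q = \<gamma> s" using q(1) by (auto simp: path_image_def)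
      then have "s \<notin> K" using r q(2) by auto
      then consider "\<bar>s - t0\<bar> < \<sigma>" | "\<bar>s - 1 - t0\<bar> < \<sigma>" using s by (auto simp: K_def)
      then show ?thesis
      proof cases
        case 1
        then show ?thesis using s \<sigma> g_pos[of s] by (intro image_eqI[of _ _ s]) (auto simp: dist_real_def)
      next
        case 2
        then show ?thesis using s \<sigma> by (intro image_eqI[of _ _ "s - 1"]) (auto simp: dist_real_def g_def)
      qed
    qed
    then show ?thesis using r(1) by blast
  qed
  then have "chords_parallel_at (path_image \<gamma>) (g t0) (g' t0)"
    using t0 by (intro chords_parallel_at_curve[OF _ gd g'c g'0]) auto
  then show ?thesis using g_pos t0 by auto
qed

section \<open>Topology of the annulus\<close>

text \<open>By the Jordan-Brouwer theorem each component of the complement has the whole curve as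
  its frontier, and inside and outside are unions of components. For the outer boundary of an
  annulus the inside is nonempty because it contains the inner curve.\<close>

lemma simple_closed_curve_closure:
  fixes \<gamma> :: "real \<Rightarrow> real^2"
  assumes \<gamma>: "simple_path \<gamma>" "pathfinish \<gamma> = pathstart \<gamma>"
  shows "inside (path_image \<gamma>) \<noteq> {} \<Longrightarrow> path_image \<gamma> \<subseteq> closure (inside (path_image \<gamma>))"
    and "path_image \<gamma> \<subseteq> closure (outside (path_image \<gamma>))"
proof -
  have "path_image \<gamma> homeomorphic sphere (0::complex) 1"
    using \<gamma> by (rule homeomorphic_simple_path_image_circle) simp
  also have "sphere (0::complex) 1 homeomorphic sphere (0::real^2) 1"
    by (rule homeomorphic_spheres_gen) auto
  finally have hom: "path_image \<gamma> homeomorphic sphere (0::real^2) 1" .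
  have sub: "path_image \<gamma> \<subseteq> closure (connected_component_set (- path_image \<gamma>) x)" if "x \<notin> path_image \<gamma>" for x
  proof -
    have "frontier (connected_component_set (- path_image \<gamma>) x) = path_image \<gamma>"
      using that by (intro Jordan_Brouwer_frontier[OF hom] componentsI) auto
    then show ?thesis by (auto simp: frontier_def)
  qed
  {
    assume "inside (path_image \<gamma>) \<noteq> {}"
    then obtain x where x: "x \<in> inside (path_image \<gamma>)" by blast
    then have "connected_component_set (- path_image \<gamma>) x \<subseteq> inside (path_image \<gamma>)"
      using inside_same_component by fastforce
    then show "path_image \<gamma> \<subseteq> closure (inside (path_image \<gamma>))"
      using sub[of x] x inside_no_overlap closure_mono by blast
  }
  obtain x where x: "x \<in> outside (path_image \<gamma>)"
    using outside_bounded_nonempty[OF bounded_simple_path_image[OF \<gamma>(1)]] by blast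
  then have "connected_component_set (- path_image \<gamma>) x \<subseteq> outside (path_image \<gamma>)"
    using outside_same_component by fastforce
  then show "path_image \<gamma> \<subseteq> closure (outside (path_image \<gamma>))"
    using sub[of x] x outside_no_overlap closure_mono by blast
qed

text \<open>These three properties are all that is used of the annulus later on. The second says
  that \<open>A\<close> has no thin parts, which makes derivatives within \<open>A\<close>
  meaningful at the boundary.\<close>

lemma C1_annulus_structure:
  assumes "C1_annulus A"
  shows "compact A" and "A \<subseteq> closure (interior A)"
    and "p \<in> frontier A \<Longrightarrow> \<exists>v. chords_parallel_at (frontier A) p v"
proof -
  obtain \<alpha> \<beta> where C1: "simple_closed_C1_curve \<alpha>" "simple_closed_C1_curve \<beta>"
    and sub: "path_image \<alpha> \<subseteq> inside (path_image \<beta>)"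
    and A: "A = (path_image \<beta> \<union> inside (path_image \<beta>)) - inside (path_image \<alpha>)"
    using assms unfolding C1_annulus_def by blast
  let ?a = "path_image \<alpha>" and ?b = "path_image \<beta>"
  have simple: "simple_path \<alpha>" "pathfinish \<alpha> = pathstart \<alpha>" "simple_path \<beta>" "pathfinish \<beta> = pathstart \<beta>"
    using C1 by (auto simp: simple_closed_C1_curve_def)
  have cpt: "compact ?a" "compact ?b" using simple by (auto simp: compact_simple_path_image)
  have cl: "closed ?a" "closed ?b" using cpt by (auto intro: compact_imp_closed)
  have op: "open (inside ?a)" "open (inside ?b)" "open (outside ?a)" "open (outside ?b)"
    using cl by (auto intro: open_inside open_outside)
  have nest: "inside ?a \<subseteq> inside ?b"
    using simple by (intro inside_inside_compact_connected cl cpt sub connected_simple_path_image)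
  have A': "A = - outside ?b - inside ?a" unfolding A union_with_inside ..
  have "closed A" unfolding A' using op by (intro closed_Diff) (auto simp: closed_def)
  moreover have "bounded A" unfolding A
    using cpt by (meson bounded_Un bounded_inside bounded_subset compact_imp_bounded Diff_subset)
  ultimately show "compact A" by (simp add: compact_eq_bounded_closed)
  \<comment> \<open>The open region between the curves. It differs from \<open>A\<close> only by the
    two curves, and each of them lies in its closure.\<close>
  define W where "W = inside ?b \<inter> outside ?a"
  have W: "open W" unfolding W_def using op by auto
  have WA: "W \<subseteq> A" unfolding A W_def using inside_Int_outside[of ?a] by blast
  then have Wint: "W \<subseteq> interior A" using W by (rule interior_maximal)
  have AW: "A \<subseteq> W \<union> ?a \<union> ?b"
    unfolding A W_def using inside_Un_outside[of ?a] by blast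
  have ab: "?a \<inter> ?b = {}" using sub inside_no_overlap[of ?b] by blast
  have "?b \<subseteq> closure W"
  proof
    fix p assume p: "p \<in> ?b"
    have "inside ?b \<noteq> {}" using sub simple by (auto simp: path_image_nonempty)
    then have "p \<in> closure (inside ?b)" using simple_closed_curve_closure(1)[OF simple(3,4)] p by blast
    moreover have "p \<in> outside ?a"
      using p ab nest inside_no_overlap[of ?b] inside_Un_outside[of ?a] by blast
    ultimately show "p \<in> closure W"
      unfolding W_def using open_Int_closure_subset[OF op(3), of "inside ?b"] by (auto simp: Int_commute)
  qed
  moreover have "?a \<subseteq> closure W"
  proof
    fix p assume p: "p \<in> ?a"
    then have "p \<in> closure (outside ?a)" using simple_closed_curve_closure(2)[OF simple(1,2)] by blast
    then show "p \<in> closure W"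
      unfolding W_def using open_Int_closure_subset[OF op(2), of "outside ?a"] p sub by auto
  qed
  ultimately have "A \<subseteq> closure W" using AW closure_subset[of W] by blast
  then show "A \<subseteq> closure (interior A)" using closure_mono[OF Wint] by blast
  assume p: "p \<in> frontier A"
  have "frontier A \<subseteq> A" using \<open>closed A\<close> by (rule frontier_subset_closed)
  then have fr: "frontier A \<subseteq> ?a \<union> ?b" using AW Wint by (auto simp: frontier_def)
  consider "p \<in> ?a" "p \<in> - ?b" | "p \<in> ?b" "p \<in> - ?a" using p fr ab by blast
  then show "\<exists>v. chords_parallel_at (frontier A) p v"
  proof cases
    case 1
    then obtain r where "r > 0" "ball p r \<subseteq> - ?b" using cl(2) by (metis open_Compl open_contains_ball)
    then show ?thesis
      using simple_closed_C1_curve_chords_parallel[OF C1(1) 1(1)] fr by (blast intro: chords_parallel_at_subset)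
  next
    case 2
    then obtain r where "r > 0" "ball p r \<subseteq> - ?a" using cl(1) by (metis open_Compl open_contains_ball)
    then show ?thesis
      using simple_closed_C1_curve_chords_parallel[OF C1(2) 2(1)] fr by (blast intro: chords_parallel_at_subset)
  qed
qed


section \<open>Uniqueness of derivatives at boundary points\<close>

text \<open>A line in the direction \<open>u\<close> through an interior point near \<open>p\<close>
  cannot meet the frontier twice near \<open>p\<close>, since the chord would be transversal to
  \<open>v\<close>. So a short move along \<open>u\<close> or along \<open>- u\<close> ends in
  \<open>A\<close>.\<close>

lemma transversal_direction_accessible:
  assumes flat: "chords_parallel_at (frontier A) p v" and p: "p \<in> closure (interior A)"
    and u: "u \<bullet> perp v \<noteq> 0" and \<eta>: "\<eta> > 0" and r: "r > 0"
  shows "\<exists>s y. 0 < \<bar>s\<bar> \<and> \<bar>s\<bar> < r \<and> y \<in> A \<and> norm (y - p - s *\<^sub>R u) \<le> \<eta> * \<bar>s\<bar>"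
proof -
  have u0: "norm u > 0" using u by auto
  \<comment> \<open>Half of the ratio that a chord in the direction \<open>u\<close> has, so two
    frontier points on such a line contradict the chord estimate.\<close>
  define \<eta>1 where "\<eta>1 = \<bar>u \<bullet> perp v\<bar> / (2 * norm u)"
  have "\<eta>1 > 0" using u u0 by (simp add: \<eta>1_def)
  then obtain r1 where r1: "r1 > 0" "\<And>q q'. q \<in> frontier A \<inter> ball p r1 \<Longrightarrow> q' \<in> frontier A \<inter> ball p r1 \<Longrightarrow>
      \<bar>(q - q') \<bullet> perp v\<bar> \<le> \<eta>1 * norm (q - q')"
    using flat unfolding chords_parallel_at_def by meson
  define s0 where "s0 = min (r / 2) (r1 / (4 * norm u))"
  have s0: "s0 > 0" "s0 < r" "s0 * norm u \<le> r1 / 4"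
    using r r1(1) u0 by (auto simp: s0_def min_def field_simps)
  have "min (\<eta> * s0) (r1 / 4) > 0" using \<eta> s0 r1(1) by simp
  then obtain z where z: "z \<in> interior A" "dist z p < min (\<eta> * s0) (r1 / 4)"
    using p unfolding closure_approachable by blast
  have zA: "z \<in> A" using z(1) interior_subset by blast
  have near: "z + (c * s) *\<^sub>R u \<in> ball p r1" if "\<bar>c\<bar> = s0" "0 \<le> s" "s \<le> 1" for c s
  proof -
    have "\<bar>s\<bar> * s0 \<le> 1 * s0" using that s0 by (intro mult_right_mono) auto
    then have "\<bar>c * s\<bar> * norm u \<le> s0 * norm u"
      using that by (intro mult_right_mono) (auto simp: abs_mult mult.commute)
    then have "norm (z - p) + norm ((c * s) *\<^sub>R u) < r1" using s0 z(2) r1(1) by (simp add: dist_norm)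
    then have "norm ((z - p) + (c * s) *\<^sub>R u) < r1" using norm_triangle_ineq order_le_less_trans by blast
    then show ?thesis by (simp add: dist_norm norm_minus_commute algebra_simps)
  qed
  have exit: "\<exists>s. 0 < s \<and> s \<le> 1 \<and> z + (c * s) *\<^sub>R u \<in> frontier A" if "z + c *\<^sub>R u \<notin> A" for c
  proof -
    have "closed_segment z (z + c *\<^sub>R u) \<inter> frontier A \<noteq> {}"
      using that zA by (intro connected_Int_frontier) auto
    then obtain s where s: "0 \<le> s" "s \<le> 1" "z + (c * s) *\<^sub>R u \<in> frontier A"
      by (auto simp: closed_segment_def algebra_simps)
    have "s \<noteq> 0" using s(3) z(1) by (auto simp: frontier_def)
    with s show ?thesis by (intro exI[of _ s]) auto
  qed
  have "\<exists>c. \<bar>c\<bar> = s0 \<and> z + c *\<^sub>R u \<in> A"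
  proof (rule ccontr)
    assume no: "\<not> ?thesis"
    have "z + s0 *\<^sub>R u \<notin> A" "z + (- s0) *\<^sub>R u \<notin> A"
      using no s0(1) by (metis abs_of_pos, metis abs_minus_cancel abs_of_pos)
    then obtain a b where a: "0 < a" "a \<le> 1" "z + (s0 * a) *\<^sub>R u \<in> frontier A"
      and b: "0 < b" "b \<le> 1" "z + (- s0 * b) *\<^sub>R u \<in> frontier A" using exit by meson
    let ?k = "s0 * a + s0 * b"
    have k: "?k > 0" using a b s0 by (simp add: add_pos_pos)
    have "(z + (s0 * a) *\<^sub>R u) - (z + (- s0 * b) *\<^sub>R u) = ?k *\<^sub>R u" by (simp add: algebra_simps)
    then have "\<bar>(?k *\<^sub>R u) \<bullet> perp v\<bar> \<le> \<eta>1 * norm (?k *\<^sub>R u)"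
      using r1(2)[of "z + (s0 * a) *\<^sub>R u" "z + (- s0 * b) *\<^sub>R u"] a b near[of s0 a] near[of "- s0" b] s0 by auto
    then have "?k * \<bar>u \<bullet> perp v\<bar> \<le> ?k * (\<bar>u \<bullet> perp v\<bar> / 2)"
      using k u0 by (simp add: \<eta>1_def abs_mult)
    then show False using k u by (simp del: distrib_left_numeral add: mult_le_cancel_left)
  qed
  then obtain c where c: "\<bar>c\<bar> = s0" "z + c *\<^sub>R u \<in> A" by blast
  have "norm (z + c *\<^sub>R u - p - c *\<^sub>R u) \<le> \<eta> * \<bar>c\<bar>" using z(2) c(1) by (simp add: dist_norm)
  with c s0 show ?thesis by (intro exI[of _ c] exI[of _ "z + c *\<^sub>R u"]) auto
qed

text \<open>\<open>E\<close>, in applications the difference of two derivatives of one map, is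
  linear and of smaller order than the displacement along \<open>A\<close>. Displacements nearly
  equal to \<open>s *\<^sub>R u\<close> transfer this smallness to \<open>u\<close> itself.\<close>

lemma has_derivative_zero_accessible:
  fixes E :: "real^2 \<Rightarrow> 'b::real_normed_vector"
  assumes E: "((\<lambda>_. c) has_derivative E) (at p within A)"
    and acc: "\<And>\<eta> r. \<eta> > 0 \<Longrightarrow> r > 0 \<Longrightarrow>
      \<exists>s y. 0 < \<bar>s\<bar> \<and> \<bar>s\<bar> < r \<and> y \<in> A \<and> norm (y - p - s *\<^sub>R u) \<le> \<eta> * \<bar>s\<bar>"
  shows "E u = 0"
proof -
  have lin: "bounded_linear E" using E by (rule has_derivative_bounded_linear)
  then obtain B where B: "B > 0" "\<And>w. norm (E w) \<le> B * norm w"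
    using bounded_linear.pos_bounded by (metis mult.commute)
  have "norm (E u) \<le> 0"
  proof (rule field_le_epsilon)
    fix e :: real assume e: "e > 0"
    \<comment> \<open>The error \<open>e\<close> is shared equally: \<epsilon> controls
      \<open>E\<close> at \<open>y - p\<close>, whose length is at most
      \<open>\<bar>s\<bar> * (norm u + 1)\<close>, and \<eta> below controls \<open>E\<close> at the
      deviation of \<open>y - p\<close> from \<open>s *\<^sub>R u\<close>.\<close>
    define \<epsilon> where "\<epsilon> = e / (2 * (norm u + 1))"
    have \<epsilon>: "\<epsilon> > 0" "\<epsilon> * (norm u + 1) = e / 2"
    proof -
      have "e / (2 * N) > 0 \<and> e / (2 * N) * N = e / 2" if "N > 0" for N using e that by simp
      from this[of "norm u + 1"] show "\<epsilon> > 0" "\<epsilon> * (norm u + 1) = e / 2"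
        unfolding \<epsilon>_def using norm_ge_zero[of u] by linarith+
    qed
    obtain d where d: "d > 0" "\<And>y. y \<in> A \<Longrightarrow> norm (y - p) < d \<Longrightarrow> norm (E (y - p)) \<le> \<epsilon> * norm (y - p)"
      using E \<epsilon>(1) unfolding has_derivative_within_alt by (auto simp: norm_minus_cancel)
    define \<eta> where "\<eta> = min 1 (e / (2 * B))"
    have \<eta>: "\<eta> > 0" "\<eta> \<le> 1" "B * \<eta> \<le> e / 2" using e B by (auto simp: \<eta>_def min_def field_simps)
    have "d / (norm u + 1) > 0" using d(1) by (simp add: add_nonneg_pos)
    then obtain s y where sy: "0 < \<bar>s\<bar>" "\<bar>s\<bar> < d / (norm u + 1)" "y \<in> A" "norm (y - p - s *\<^sub>R u) \<le> \<eta> * \<bar>s\<bar>"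
      using acc[OF \<eta>(1)] by blast
    have "norm (y - p) \<le> norm (s *\<^sub>R u) + norm (y - p - s *\<^sub>R u)"
      using norm_triangle_ineq[of "s *\<^sub>R u" "y - p - s *\<^sub>R u"] by simp
    also have "\<dots> \<le> \<bar>s\<bar> * norm u + 1 * \<bar>s\<bar>"
      using sy(4) mult_right_mono[OF \<eta>(2), of "\<bar>s\<bar>"] by simp
    also have "\<dots> = \<bar>s\<bar> * (norm u + 1)" by (simp add: algebra_simps)
    finally have n: "norm (y - p) \<le> \<bar>s\<bar> * (norm u + 1)" .
    also have "\<dots> < d" using sy(2) by (simp add: pos_less_divide_eq add_nonneg_pos)
    finally have "norm (E (y - p)) \<le> \<epsilon> * norm (y - p)" using d(2) sy(3) by blast
    also have "\<dots> \<le> \<epsilon> * (\<bar>s\<bar> * (norm u + 1))" using n \<epsilon>(1) by (intro mult_left_mono) auto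
    also have "\<dots> = \<bar>s\<bar> * (e / 2)" unfolding \<epsilon>(2)[symmetric] by simp
    finally have 1: "norm (E (y - p)) \<le> \<bar>s\<bar> * (e / 2)" .
    have "norm (E (y - p - s *\<^sub>R u)) \<le> B * (\<eta> * \<bar>s\<bar>)"
      using B sy(4) by (meson mult_left_mono order_trans less_imp_le)
    also have "\<dots> \<le> \<bar>s\<bar> * (e / 2)" using mult_right_mono[OF \<eta>(3), of "\<bar>s\<bar>"] by (simp add: mult_ac)
    finally have 2: "norm (E (y - p - s *\<^sub>R u)) \<le> \<bar>s\<bar> * (e / 2)" .
    have "\<bar>s\<bar> * norm (E u) = norm (E (y - p) - E (y - p - s *\<^sub>R u))"
      using lin by (simp add: linear_diff[OF bounded_linear.linear] linear_scale[OF bounded_linear.linear])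
    also have "\<dots> \<le> \<bar>s\<bar> * e" using 1 2 norm_triangle_ineq4[of "E (y - p)" "E (y - p - s *\<^sub>R u)"] by simp
    finally show "norm (E u) \<le> 0 + e" using sy(1) by simp
  qed
  then show ?thesis by simp
qed

text \<open>On the boundary the two transversal directions \<open>perp v\<close> and \<open>v + perp v\<close> already
  determine the derivative.\<close>

lemma derivative_within_unique:
  fixes f :: "real^2 \<Rightarrow> 'b::real_normed_vector"
  assumes A: "A \<subseteq> closure (interior A)"
    and flat: "p \<in> frontier A \<Longrightarrow> \<exists>v. chords_parallel_at (frontier A) p v"
    and p: "p \<in> A" and D: "(f has_derivative D) (at p within A)" "(f has_derivative D') (at p within A)"
  shows "D = D'"
proof -
  have E: "((\<lambda>_. 0) has_derivative (\<lambda>h. D h - D' h)) (at p within A)"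
    using has_derivative_diff[OF D] by simp
  have lin: "linear (\<lambda>h. D h - D' h)" using E by (rule has_derivative_linear)
  show ?thesis
  proof (cases "p \<in> interior A")
    case True
    then have "at p within A = at p" by (rule at_within_interior)
    then show ?thesis using D has_derivative_unique by metis
  next
    case False
    then have "p \<in> frontier A" using p closure_subset by (auto simp: frontier_def)
    then obtain v where v: "chords_parallel_at (frontier A) p v" using flat by blast
    have v0: "v \<bullet> v > 0" using v by (simp add: chords_parallel_at_def)
    have zero: "D u - D' u = 0" if "u \<bullet> perp v \<noteq> 0" for u
      using p A that by (intro has_derivative_zero_accessible[OF E] transversal_direction_accessible[OF v]) auto
    have pp: "perp v \<bullet> perp v = v \<bullet> v" by (simp add: inner_2)
    have 1: "D (perp v) - D' (perp v) = 0" by (rule zero) (use v0 pp in simp)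
    have "D (v + perp v) - D' (v + perp v) = 0" by (rule zero) (use v0 pp in \<open>simp add: inner_left_distrib\<close>)
    then have 2: "D v - D' v = 0" using linear_add[OF lin, of v "perp v"] 1 by simp
    show ?thesis
    proof
      fix w
      have "(v \<bullet> v) *\<^sub>R (D w - D' w) = D ((v \<bullet> v) *\<^sub>R w) - D' ((v \<bullet> v) *\<^sub>R w)"
        using linear_scale[OF lin] by simp
      also have "\<dots> = 0"
        unfolding perp_decomposition[of v w]
        using linear_add[OF lin, of "(w \<bullet> v) *\<^sub>R v"] linear_scale[OF lin] 1 2 by simp
      finally show "D w = D' w" using v0 by simp
    qed
  qed
qed

text \<open>The difference quotients of a curve in \<open>S\<close> are scaled chords, so their
  limit \<open>w\<close> is orthogonal to \<open>perp v\<close> and thus a multiple of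
  \<open>v\<close>. This replaces the unspecified direction \<open>v\<close> by the value of the
  field.\<close>

lemma tangent_vector_chords_parallel:
  assumes flat: "chords_parallel_at S p v" and w: "tangent_vector S p w" "w \<noteq> 0"
  shows "chords_parallel_at S p w"
proof -
  have v0: "v \<noteq> 0" using flat by (simp add: chords_parallel_at_def)
  obtain c e where c: "e > 0" "c 0 = p" "\<And>s. s \<in> {-e<..<e} \<Longrightarrow> c s \<in> S" "(c has_vector_derivative w) (at 0)"
    using w(1) unfolding tangent_vector_def by blast
  have lim: "((\<lambda>s. (c s - p) /\<^sub>R s) \<longlongrightarrow> w) (at 0)"
  proof -
    have "((\<lambda>s. norm (c s - p - s *\<^sub>R w) / norm s) \<longlongrightarrow> 0) (at 0)"
      using c(2,4) by (simp add: has_vector_derivative_def has_derivative_at)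
    moreover have "\<forall>\<^sub>F s in at 0. norm (c s - p - s *\<^sub>R w) / norm s = norm ((c s - p) /\<^sub>R s - w)"
    proof -
      have "norm (c s - p - s *\<^sub>R w) / norm s = norm ((c s - p) /\<^sub>R s - w)" if "s \<noteq> 0" for s
      proof -
        have "(c s - p) /\<^sub>R s - w = (c s - p - s *\<^sub>R w) /\<^sub>R s" using that by (simp add: scaleR_diff_right)
        then show ?thesis by (simp add: divide_inverse mult.commute)
      qed
      then show ?thesis by (simp add: eventually_at_filter)
    qed
    ultimately have "((\<lambda>s. norm ((c s - p) /\<^sub>R s - w)) \<longlongrightarrow> 0) (at 0)"
      by (rule Lim_transform_eventually)
    then show ?thesis by (simp add: tendsto_norm_zero_iff flip: Lim_null)
  qed
  have "\<bar>w \<bullet> perp v\<bar> \<le> \<eta> * norm w" if \<eta>: "\<eta> > 0" for \<eta>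
  proof -
    obtain r where r: "r > 0" "\<And>q q'. q \<in> S \<inter> ball p r \<Longrightarrow> q' \<in> S \<inter> ball p r \<Longrightarrow> \<bar>(q - q') \<bullet> perp v\<bar> \<le> \<eta> * norm (q - q')"
      using flat \<eta> unfolding chords_parallel_at_def by meson
    have "isCont c 0" using c(4) by (rule has_vector_derivative_continuous)
    then have "\<forall>\<^sub>F s in at 0. dist (c s) p < r"
      using r(1) c(2) by (metis isCont_def tendstoD)
    moreover have "\<forall>\<^sub>F s in at 0. s \<in> {-e<..<e}"
      using c(1) by (intro eventually_at_in_open') auto
    ultimately have "\<forall>\<^sub>F s in at 0. \<bar>((c s - p) /\<^sub>R s) \<bullet> perp v\<bar> \<le> \<eta> * norm ((c s - p) /\<^sub>R s)"
    proof eventually_elim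
      case (elim s)
      have "p \<in> S" using c(1,2) c(3)[of 0] by simp
      then have "\<bar>(c s - p) \<bullet> perp v\<bar> \<le> \<eta> * norm (c s - p)"
        using elim c(3) r by (intro r(2)) (auto simp: dist_commute)
      then have "\<bar>inverse s\<bar> * \<bar>(c s - p) \<bullet> perp v\<bar> \<le> \<bar>inverse s\<bar> * (\<eta> * norm (c s - p))"
        by (rule mult_left_mono) simp
      then show ?case by (simp add: abs_mult mult_ac)
    qed
    then show ?thesis
      by (rule tendsto_le[OF trivial_limit_at, rotated 2]) (intro tendsto_intros lim)+
  qed
  then have "\<bar>w \<bullet> perp v\<bar> \<le> 0 + e'" if "e' > 0" for e'
    using that[THEN divide_pos_pos, of "norm w"] w(2) by (metis add_0 nonzero_eq_divide_eq norm_eq_zero zero_less_norm_iff)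
  then have "w \<bullet> perp v = 0" using field_le_epsilon[of "\<bar>w \<bullet> perp v\<bar>" 0] by simp
  then obtain k where k: "w = k *\<^sub>R v" using orthogonal_perp v0 by blast
  show ?thesis
    unfolding chords_parallel_at_def
  proof (intro conjI allI impI)
    fix \<eta> :: real assume "\<eta> > 0"
    have k0: "\<bar>k\<bar> > 0" using k w(2) by auto
    then have "\<eta> / \<bar>k\<bar> > 0" using \<open>\<eta> > 0\<close> by simp
    then obtain r where r: "r > 0" "\<And>q q'. q \<in> S \<inter> ball p r \<Longrightarrow> q' \<in> S \<inter> ball p r \<Longrightarrow> \<bar>(q - q') \<bullet> perp v\<bar> \<le> \<eta> / \<bar>k\<bar> * norm (q - q')"
      using flat unfolding chords_parallel_at_def by meson
    have "\<bar>(q - q') \<bullet> perp w\<bar> \<le> \<eta> * norm (q - q')" if "q \<in> S \<inter> ball p r" "q' \<in> S \<inter> ball p r" for q q'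
      using mult_left_mono[OF r(2)[OF that], of "\<bar>k\<bar>"] k0 by (simp add: k perp_scaleR abs_mult)
    then show "\<exists>r>0. \<forall>q\<in>S \<inter> ball p r. \<forall>q'\<in>S \<inter> ball p r. \<bar>(q - q') \<bullet> perp w\<bar> \<le> \<eta> * norm (q - q')"
      using r(1) by blast
  qed fact
qed

text \<open>A segment that joins points of \<open>A\<close> and leaves \<open>A\<close> at
  \<open>m\<close> meets the frontier on both sides of \<open>m\<close>. If this happened for
  arbitrarily short normal segments, then near a limit point \<open>p\<close> there would be a
  frontier chord orthogonal to a value of the field close to \<open>Y p\<close>, whereas chords
  there are nearly parallel to \<open>Y p\<close>.\<close>

lemma transversal_segment_subset:
  assumes A: "compact A" and Y: "continuous_on A Y"
    and flat: "\<And>p. p \<in> frontier A \<Longrightarrow> chords_parallel_at (frontier A) p (Y p)"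
  shows "\<exists>d>0. \<forall>x\<in>A. \<forall>z\<in>A. dist x z < d \<longrightarrow> (z - x) \<bullet> Y x = 0 \<longrightarrow> closed_segment x z \<subseteq> A"
proof (rule ccontr)
  assume no: "\<not> ?thesis"
  have clA: "closed A" using A by (rule compact_imp_closed)
  have "\<exists>x z m. x \<in> A \<and> z \<in> A \<and> dist x z < 1 / real (Suc n) \<and> (z - x) \<bullet> Y x = 0 \<and> m \<in> closed_segment x z \<and> m \<notin> A" for n
    using no by (metis of_nat_0_less_iff subsetI zero_less_Suc zero_less_divide_1_iff)
  then obtain x z m where xzm: "\<And>n. x n \<in> A" "\<And>n. z n \<in> A" "\<And>n. dist (x n) (z n) < 1 / real (Suc n)"
    "\<And>n. (z n - x n) \<bullet> Y (x n) = 0" "\<And>n. m n \<in> closed_segment (x n) (z n)" "\<And>n. m n \<notin> A" by metis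
  obtain p \<sigma> where p: "p \<in> A" and \<sigma>: "strict_mono \<sigma>" and lim: "(x \<circ> \<sigma>) \<longlonglongrightarrow> p"
    using A xzm(1) unfolding compact_def by blast
  have close: "\<forall>\<^sub>F n in sequentially. dist (x (\<sigma> n)) p < r \<and> dist (x (\<sigma> n)) (z (\<sigma> n)) < r" if "r > 0" for r
  proof (rule eventually_conj)
    show "\<forall>\<^sub>F n in sequentially. dist (x (\<sigma> n)) p < r" using lim that by (auto dest: tendstoD simp: o_def)
    have "(\<lambda>n. 1 / real (Suc (\<sigma> n))) \<longlonglongrightarrow> 0"
      using LIMSEQ_subseq_LIMSEQ[OF lim_1_over_n[THEN LIMSEQ_Suc] \<sigma>] by (simp add: o_def)
    then have "\<forall>\<^sub>F n in sequentially. 1 / real (Suc (\<sigma> n)) < r" using that by (rule order_tendstoD)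
    then show "\<forall>\<^sub>F n in sequentially. dist (x (\<sigma> n)) (z (\<sigma> n)) < r"
      by eventually_elim (use xzm(3) less_trans in blast)
  qed
  have mclose: "dist p q < r" if "dist (x n) p < r / 2" "dist (x n) (z n) < r / 2" "q \<in> closed_segment (x n) (z n)" for n q r
  proof -
    have "dist (x n) q \<le> dist (x n) (z n)" using dist_in_closed_segment[OF that(3)] by (simp add: dist_commute)
    then show ?thesis using that dist_triangle[of p q "x n"] by (simp add: dist_commute)
  qed
  have "p \<notin> interior A"
  proof
    assume "p \<in> interior A"
    then obtain r where r: "r > 0" "ball p r \<subseteq> A" by (auto simp: mem_interior)
    have "\<forall>\<^sub>F n in sequentially. dist (x (\<sigma> n)) p < r / 2 \<and> dist (x (\<sigma> n)) (z (\<sigma> n)) < r / 2"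
      by (rule close[OF half_gt_zero[OF r(1)]])
    from eventually_happens'[OF sequentially_bot this]
    obtain n where "dist (x (\<sigma> n)) p < r / 2" "dist (x (\<sigma> n)) (z (\<sigma> n)) < r / 2" by blast
    then have "m (\<sigma> n) \<in> ball p r" using mclose[OF _ _ xzm(5)] unfolding mem_ball by blast
    then show False using r xzm(6) by blast
  qed
  then have "p \<in> frontier A" using p closure_subset by (auto simp: frontier_def)
  then have fl: "chords_parallel_at (frontier A) p (Y p)" by (rule flat)
  then have Yp: "norm (Y p) > 0" by (simp add: chords_parallel_at_def)
  \<comment> \<open>One third of the length of \<open>Y p\<close> goes to the chord estimate and one
    third to each of the two uses of continuity of \<open>Y\<close> in the final inequality.\<close>
  then have "norm (Y p) / 3 > 0" by simp
  then obtain r where r: "r > 0" "\<And>q q'. q \<in> frontier A \<inter> ball p r \<Longrightarrow> q' \<in> frontier A \<inter> ball p r \<Longrightarrow>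
      \<bar>(q - q') \<bullet> perp (Y p)\<bar> \<le> norm (Y p) / 3 * norm (q - q')"
    using fl unfolding chords_parallel_at_def by meson
  have "(\<lambda>n. Y (x (\<sigma> n))) \<longlonglongrightarrow> Y p"
    using Y lim xzm(1) p unfolding continuous_on_sequentially by (auto simp: o_def)
  then have "\<forall>\<^sub>F n in sequentially. dist (Y (x (\<sigma> n))) (Y p) < norm (Y p) / 3" using Yp by (intro tendstoD) auto
  then have "\<forall>\<^sub>F n in sequentially. dist (Y (x (\<sigma> n))) (Y p) < norm (Y p) / 3 \<and>
      dist (x (\<sigma> n)) p < r / 2 \<and> dist (x (\<sigma> n)) (z (\<sigma> n)) < r / 2"
    using close[of "r / 2"] r(1) by (simp add: eventually_conj_iff)
  from eventually_happens'[OF sequentially_bot this]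
  obtain k where k: "dist (Y (x k)) (Y p) < norm (Y p) / 3" "dist (x k) p < r / 2" "dist (x k) (z k) < r / 2" by blast
  have fr: "\<exists>q. q \<in> closed_segment a (m k) \<and> q \<in> frontier A" if "a \<in> A" for a
    using connected_Int_frontier[of "closed_segment a (m k)" A] that xzm(6)[of k] by blast
  obtain q where q: "q \<in> closed_segment (x k) (m k)" "q \<in> frontier A" using fr xzm(1) by blast
  obtain q' where q': "q' \<in> closed_segment (z k) (m k)" "q' \<in> frontier A" using fr xzm(2) by blast
  have sub: "closed_segment (x k) (m k) \<subseteq> closed_segment (x k) (z k)"
    "closed_segment (z k) (m k) \<subseteq> closed_segment (x k) (z k)"
    using xzm(5)[of k] by (auto simp: subset_closed_segment)
  have "q \<in> ball p r" "q' \<in> ball p r" using mclose[OF k(2,3)] q q' sub by auto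
  then have chord: "\<bar>(q - q') \<bullet> perp (Y p)\<bar> \<le> norm (Y p) / 3 * norm (q - q')" using r(2) q q' by blast
  have fA: "frontier A \<subseteq> A" using clA by (rule frontier_subset_closed)
  \<comment> \<open>The point \<open>m k\<close> lies between \<open>q\<close> and
    \<open>q'\<close>, so equality would give \<open>q = m k\<close>, a point off
    \<open>A\<close>.\<close>
  have "q \<noteq> q'"
  proof
    assume "q = q'"
    have seg: "dist a b = dist a c + dist c b" if "c \<in> closed_segment a b" for a b c :: "real^2"
      using that by (simp only: between_mem_segment[symmetric] between)
    have "q \<in> closed_segment (x k) (z k)" "q \<in> closed_segment (z k) (m k)" using q q' sub \<open>q = q'\<close> by auto
    then have "dist (x k) (z k) = dist (x k) q + dist q (z k)" "dist (z k) (m k) = dist (z k) q + dist q (m k)"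
      "dist (x k) (m k) = dist (x k) q + dist q (m k)" "dist (x k) (z k) = dist (x k) (m k) + dist (m k) (z k)"
      using q(1) xzm(5)[of k] by (auto dest: seg)
    then have "dist q (m k) = 0" by (simp add: dist_commute)
    then show False using q(2) fA xzm(6)[of k] by auto
  qed
  have param: "\<exists>a. c = x k + a *\<^sub>R (z k - x k)" if "c \<in> closed_segment (x k) (z k)" for c
    using that by (auto simp: in_segment algebra_simps)
  obtain a b where ab: "q = x k + a *\<^sub>R (z k - x k)" "q' = x k + b *\<^sub>R (z k - x k)"
    using param[of q] param[of q'] q q' sub by blast
  have "(q - q') \<bullet> Y (x k) = 0" using xzm(4)[of k] by (simp add: ab algebra_simps inner_diff_left inner_add_left)
  then have "norm (Y (x k)) * norm (q - q') = \<bar>(q - q') \<bullet> perp (Y (x k))\<bar>" by (simp add: abs_inner_perp_eq)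
  also have "\<dots> \<le> \<bar>(q - q') \<bullet> perp (Y p)\<bar> + \<bar>(q - q') \<bullet> perp (Y (x k) - Y p)\<bar>"
    by (simp add: perp_diff inner_diff_right)
  also have "\<dots> \<le> norm (Y p) / 3 * norm (q - q') + norm (q - q') * norm (Y (x k) - Y p)"
    using chord Cauchy_Schwarz_ineq2[of "q - q'" "perp (Y (x k) - Y p)"] by simp
  also have "\<dots> = (norm (Y p) / 3 + norm (Y (x k) - Y p)) * norm (q - q')" by (simp add: algebra_simps)
  finally have "norm (Y (x k)) \<le> norm (Y p) / 3 + norm (Y (x k) - Y p)" using \<open>q \<noteq> q'\<close> by simp
  moreover have "norm (Y p) \<le> norm (Y (x k)) + norm (Y (x k) - Y p)" by norm
  ultimately show False using k(1) by (simp add: dist_norm)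
qed

subsection \<open>Flux and linearization\<close>


text \<open>A closed neighbourhood of \<open>A\<close> inside \<open>U\<close> is compact, so
  \<open>F'\<close> is uniformly continuous on it. Working in this neighbourhood matters because a
  segment between two points of \<open>A\<close> may leave \<open>A\<close>.\<close>

lemma C1_uniform_linearization:
  fixes F :: "'a::euclidean_space \<Rightarrow> 'b::euclidean_space" and F' :: "'a \<Rightarrow> 'a \<Rightarrow>\<^sub>L 'b"
  assumes A: "compact A" "A \<subseteq> U" "open U"
    and F: "\<And>x. x \<in> U \<Longrightarrow> (F has_derivative blinfun_apply (F' x)) (at x)" "continuous_on U F'"
    and \<epsilon>: "\<epsilon> > 0"
  shows "\<exists>d>0. \<forall>x\<in>A. \<forall>z. dist x z < d \<longrightarrow> norm (F z - F x - F' x (z - x)) \<le> \<epsilon> * norm (z - x)"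
proof (cases "A = {}")
  case True
  then show ?thesis by (intro exI[of _ 1]) auto
next
  case False
  obtain e where e: "e > 0" "{x. infdist x A \<le> e} \<subseteq> U"
    using compact_in_open_separated[OF False A(1,3,2)] by blast
  let ?K = "{x. infdist x A \<le> e}"
  have "uniformly_continuous_on ?K F'"
    by (intro compact_uniformly_continuous compact_infdist_le continuous_on_subset[OF F(2)] False A e)
  then obtain d where d: "d > 0" "\<And>x y. x \<in> ?K \<Longrightarrow> y \<in> ?K \<Longrightarrow> dist y x < d \<Longrightarrow> dist (F' y) (F' x) < \<epsilon>"
    using \<epsilon> unfolding uniformly_continuous_on_def by metis
  have "norm (F z - F x - F' x (z - x)) \<le> \<epsilon> * norm (z - x)" if x: "x \<in> A" and z: "dist x z < min d e" for x z
  proof -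
    let ?S = "ball x (min d e)"
    have S: "?S \<subseteq> ?K"
    proof
      fix y assume "y \<in> ?S"
      then have "dist y x < e" by (simp add: dist_commute)
      moreover have "infdist y A \<le> dist y x" by (rule infdist_le[OF x])
      ultimately show "y \<in> ?K" by simp
    qed
    have "norm (F z - F x - F' x (z - x)) \<le> norm (z - x) * \<epsilon>"
    proof (rule differentiable_bound_linearization[where S="?S"])
      fix t :: real assume t: "t \<in> {0..1}"
      have "t * norm (z - x) \<le> 1 * norm (z - x)" using t by (intro mult_right_mono) auto
      then show "x + t *\<^sub>R (z - x) \<in> ?S" using z t by (simp add: dist_norm norm_minus_commute)
    next
      fix y assume y: "y \<in> ?S"
      show "(F has_derivative F' y) (at y within ?S)"
        using F(1)[of y] S y e(2) by (blast intro: has_derivative_at_withinI)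
      have "dist (F' y) (F' x) < \<epsilon>" using y S d(2)[of x y] e(1) x by (auto simp: dist_commute)
      then have "norm (F' y - F' x) \<le> \<epsilon>" by (simp add: dist_norm)
      then show "onorm (blinfun_apply (F' y) - blinfun_apply (F' x)) \<le> \<epsilon>"
        by (simp add: norm_blinfun.rep_eq minus_blinfun.rep_eq fun_diff_def)
    qed (use d e in auto)
    then show ?thesis by (simp add: mult.commute)
  qed
  then show ?thesis using d(1) e(1) by (intro exI[of _ "min d e"]) auto
qed

text \<open>Since \<open>A\<close> need not be convex, the bound is split: nearby points are handled
  by the linearization, points at distance at least \<open>d\<close> by boundedness of
  \<open>F\<close>.\<close>

lemma C1_on_compact_lipschitz:
  fixes F :: "'a::euclidean_space \<Rightarrow> 'b::euclidean_space" and F' :: "'a \<Rightarrow> 'a \<Rightarrow>\<^sub>L 'b"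
  assumes A: "compact A" "A \<subseteq> U" "open U"
    and F: "\<And>x. x \<in> U \<Longrightarrow> (F has_derivative blinfun_apply (F' x)) (at x)" "continuous_on U F'"
  shows "\<exists>L>0. L-lipschitz_on A F"
proof -
  obtain d where d: "d > 0" "\<And>x z. x \<in> A \<Longrightarrow> dist x z < d \<Longrightarrow> norm (F z - F x - F' x (z - x)) \<le> 1 * norm (z - x)"
    using C1_uniform_linearization[OF A F, of 1] by (metis zero_less_one)
  have "continuous_on U F" using F(1) by (meson has_derivative_continuous continuous_at_imp_continuous_on)
  then have "bounded (F ` A)" "bounded (F' ` A)"
    using A F(2) by (auto intro!: compact_imp_bounded compact_continuous_image intro: continuous_on_subset)
  then obtain M B where MB: "M > 0" "\<And>x. x \<in> A \<Longrightarrow> norm (F x) \<le> M" "B > 0" "\<And>x. x \<in> A \<Longrightarrow> norm (F' x) \<le> B"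
    unfolding bounded_pos by (metis imageI)
  have "norm (F z - F x) \<le> (1 + B + 2 * M / d) * norm (z - x)" if "x \<in> A" "z \<in> A" for x z
  proof (cases "dist x z < d")
    case True
    have "norm (F z - F x) \<le> norm (F z - F x - F' x (z - x)) + norm (F' x (z - x))"
      by (metis diff_add_cancel norm_triangle_ineq)
    also have "\<dots> \<le> 1 * norm (z - x) + B * norm (z - x)"
    proof (rule add_mono[OF d(2)[OF that(1) True]])
      show "norm (F' x (z - x)) \<le> B * norm (z - x)"
        using norm_blinfun[of "F' x" "z - x"] mult_right_mono[OF MB(4)[OF that(1)] norm_ge_zero[of "z - x"]] by simp
    qed
    also have "\<dots> \<le> (1 + B + 2 * M / d) * norm (z - x)" using MB(1) d(1) by (simp add: distrib_right)
    finally show ?thesis .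
  next
    case False
    have "norm (F z - F x) \<le> 2 * M / d * d" using norm_triangle_ineq4[of "F z" "F x"] MB(2)[of x] MB(2)[of z] that d(1) by simp
    also have "\<dots> \<le> 2 * M / d * norm (z - x)"
      using False MB(1) d(1) by (intro mult_left_mono) (auto simp: dist_norm norm_minus_commute)
    also have "\<dots> \<le> (1 + B + 2 * M / d) * norm (z - x)" using MB(3) by (simp add: distrib_right)
    finally show ?thesis .
  qed
  then have "(1 + B + 2 * M / d)-lipschitz_on A F"
    using MB d(1) by (intro lipschitz_onI) (auto simp: dist_norm norm_minus_commute)
  moreover have "1 + B + 2 * M / d > 0" using MB d(1) by (simp add: add_pos_pos)
  ultimately show ?thesis by blast
qed

text \<open>Implicit differentiation of a branch \<sigma> already known to be continuous. The
  linearization with tolerance \<open>\<bar>b\<bar> / 2\<close> bounds the increments of \<sigma> by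
  \<open>C\<close> times those of \<open>t\<close>; after that every smaller tolerance becomes an
  error relative to \<open>\<bar>s - t\<bar>\<close> alone.\<close>

lemma implicit_has_real_derivative:
  fixes \<Psi> :: "real \<times> real \<Rightarrow> real"
  assumes \<Psi>: "(\<Psi> has_derivative (\<lambda>(h, k). a * h + b * k)) (at (t, \<sigma> t))" and b: "b \<noteq> 0"
    and \<sigma>: "isCont \<sigma> t" and zero: "\<forall>\<^sub>F s in nhds t. \<Psi> (s, \<sigma> s) = 0"
  shows "(\<sigma> has_real_derivative - a / b) (at t)"
proof -
  have z0: "\<Psi> (t, \<sigma> t) = 0" using zero by (rule eventually_nhds_x_imp_x)
  have lin: "\<forall>\<^sub>F s in nhds t. \<bar>a * (s - t) + b * (\<sigma> s - \<sigma> t)\<bar> \<le> e * (\<bar>s - t\<bar> + \<bar>\<sigma> s - \<sigma> t\<bar>)" if e: "e > 0" for e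
  proof -
    obtain d where d: "d > 0" "\<And>p. norm (p - (t, \<sigma> t)) < d \<Longrightarrow>
        norm (\<Psi> p - \<Psi> (t, \<sigma> t) - (case p - (t, \<sigma> t) of (h, k) \<Rightarrow> a * h + b * k)) \<le> e * norm (p - (t, \<sigma> t))"
      using \<Psi> e unfolding has_derivative_at_alt by metis
    have "(\<sigma> \<longlongrightarrow> \<sigma> t) (nhds t)" using \<sigma> by (simp add: isCont_def tendsto_at_iff_tendsto_nhds)
    then have "((\<lambda>s. norm ((s, \<sigma> s) - (t, \<sigma> t))) \<longlongrightarrow> norm ((t, \<sigma> t) - (t, \<sigma> t))) (nhds t)"
      by (intro tendsto_intros filterlim_ident)
    then have "\<forall>\<^sub>F s in nhds t. norm ((s, \<sigma> s) - (t, \<sigma> t)) < d" using d(1) by (intro order_tendstoD(2)) auto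
    from eventually_conj[OF zero this] show ?thesis
    proof (rule eventually_mono)
      fix s assume elim: "\<Psi> (s, \<sigma> s) = 0 \<and> norm ((s, \<sigma> s) - (t, \<sigma> t)) < d"
      have "norm ((s, \<sigma> s) - (t, \<sigma> t)) < d" using elim by (rule conjunct2)
      from d(2)[OF this]
      have "\<bar>a * (s - t) + b * (\<sigma> s - \<sigma> t)\<bar> \<le> e * norm ((s, \<sigma> s) - (t, \<sigma> t))"
        using elim z0 by simp
      moreover have "e * norm ((s, \<sigma> s) - (t, \<sigma> t)) \<le> e * (\<bar>s - t\<bar> + \<bar>\<sigma> s - \<sigma> t\<bar>)"
        using norm_Pair_le[of "s - t" "\<sigma> s - \<sigma> t"] e by (intro mult_left_mono) auto
      ultimately show "\<bar>a * (s - t) + b * (\<sigma> s - \<sigma> t)\<bar> \<le> e * (\<bar>s - t\<bar> + \<bar>\<sigma> s - \<sigma> t\<bar>)"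
        by (rule order_trans)
    qed
  qed
  define C where "C = 2 * \<bar>a\<bar> / \<bar>b\<bar> + 1"
  have C: "C > 0" by (simp add: C_def add_nonneg_pos)
  have bound: "\<forall>\<^sub>F s in nhds t. \<bar>\<sigma> s - \<sigma> t\<bar> \<le> C * \<bar>s - t\<bar>"
    using lin[of "\<bar>b\<bar> / 2"]
  proof (rule eventually_mono)
    fix s assume s: "\<bar>a * (s - t) + b * (\<sigma> s - \<sigma> t)\<bar> \<le> \<bar>b\<bar> / 2 * (\<bar>s - t\<bar> + \<bar>\<sigma> s - \<sigma> t\<bar>)"
    have "\<bar>b\<bar> * \<bar>\<sigma> s - \<sigma> t\<bar> \<le> \<bar>a * (s - t) + b * (\<sigma> s - \<sigma> t)\<bar> + \<bar>a\<bar> * \<bar>s - t\<bar>"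
      using abs_triangle_ineq4[of "a * (s - t) + b * (\<sigma> s - \<sigma> t)" "a * (s - t)"] by (simp add: abs_mult)
    also note s
    finally have "\<bar>b\<bar> * \<bar>\<sigma> s - \<sigma> t\<bar> \<le> (2 * \<bar>a\<bar> + \<bar>b\<bar>) * \<bar>s - t\<bar>" by (simp add: algebra_simps)
    also have "2 * \<bar>a\<bar> + \<bar>b\<bar> = \<bar>b\<bar> * C" using b by (simp add: C_def distrib_left)
    finally show "\<bar>\<sigma> s - \<sigma> t\<bar> \<le> C * \<bar>s - t\<bar>" using b by simp
  qed (use b in auto)
  show ?thesis
    unfolding has_field_derivative_def has_derivative_at_alt
  proof (intro conjI allI impI)
    fix e :: real assume e: "e > 0"
    define e' where "e' = e * \<bar>b\<bar> / (1 + C)"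
    have e': "e' > 0" "e' * (1 + C) = e * \<bar>b\<bar>" using e b C by (auto simp: e'_def)
    have "\<forall>\<^sub>F s in nhds t. norm (\<sigma> s - \<sigma> t - - a / b * (s - t)) \<le> e * norm (s - t)"
      using bound lin[OF e'(1)]
    proof eventually_elim
      case (elim s)
      have "\<bar>b\<bar> * norm (\<sigma> s - \<sigma> t - - a / b * (s - t)) = \<bar>a * (s - t) + b * (\<sigma> s - \<sigma> t)\<bar>"
      proof -
        have "b * (\<sigma> s - \<sigma> t - - a / b * (s - t)) = a * (s - t) + b * (\<sigma> s - \<sigma> t)"
          using b by (simp add: distrib_left right_diff_distrib)
        then show ?thesis by (simp only: real_norm_def abs_mult[symmetric])
      qed
      also have "\<dots> \<le> e' * (\<bar>s - t\<bar> + \<bar>\<sigma> s - \<sigma> t\<bar>)" by (rule elim(2))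
      also have "\<dots> \<le> e' * ((1 + C) * \<bar>s - t\<bar>)"
        unfolding distrib_right mult_1 using elim(1) less_imp_le[OF e'(1)]
        by (intro mult_left_mono add_left_mono)
      also have "\<dots> = e' * (1 + C) * \<bar>s - t\<bar>" by simp
      also have "\<dots> = \<bar>b\<bar> * (e * norm (s - t))" unfolding e'(2) by simp
      finally show ?case using b mult_le_cancel_left_pos[of "\<bar>b\<bar>"] zero_less_abs_iff by blast
    qed
    then show "\<exists>d>0. \<forall>y. norm (y - t) < d \<longrightarrow> norm (\<sigma> y - \<sigma> t - - a / b * (y - t)) \<le> e * norm (y - t)"
      unfolding eventually_nhds_metric dist_norm .
  qed (rule bounded_linear_mult_right)
qed

section \<open>Trace and conserved flux\<close>

lemma linear_real2:
  fixes T :: "real^2 \<Rightarrow> real^2"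
  assumes T: "linear T"
  shows "T v = v $ 1 *\<^sub>R T (axis 1 1) + v $ 2 *\<^sub>R T (axis 2 1)"
proof -
  have "v = v $ 1 *\<^sub>R axis 1 1 + v $ 2 *\<^sub>R axis 2 1" by (simp add: vec_eq_iff forall_2 axis_def)
  then have "T v = T (v $ 1 *\<^sub>R axis 1 1 + v $ 2 *\<^sub>R axis 2 1)" by (rule arg_cong)
  then show ?thesis by (simp only: linear_add[OF T] linear_scale[OF T])
qed

text \<open>\<open>perp w \<bullet> v\<close> is the determinant of the pair \<open>w\<close>,
  \<open>v\<close>, and the identity is the derivative of the determinant along \<open>T\<close>:
  det(w, T v) + det(T w, v) = tr(T) det(w, v).\<close>

lemma perp_trace_identity:
  fixes T :: "real^2 \<Rightarrow> real^2"
  assumes "linear T"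
  shows "perp w \<bullet> T v - perp v \<bullet> T w = (\<Sum>i\<in>UNIV. T (axis i 1) $ i) * (perp w \<bullet> v)"
proof -
  define a b where "a = T (axis 1 1)" and "b = T (axis 2 1)"
  have "T v = v $ 1 *\<^sub>R a + v $ 2 *\<^sub>R b" "T w = w $ 1 *\<^sub>R a + w $ 2 *\<^sub>R b"
    unfolding a_def b_def by (rule linear_real2[OF assms])+
  moreover have "(\<Sum>i\<in>UNIV. T (axis i 1) $ i) = a $ 1 + b $ 2" by (simp add: sum_2 a_def b_def)
  ultimately show ?thesis by (simp add: inner_2 algebra_simps)
qed

text \<open>The flux of a divergence-free field through a moving segment is constant when both end
  points move along the field: by \<open>perp_trace_identity\<close> the integrand of its time derivative
  is the derivative of \<open>perp (x' + u w') \<bullet> F (x + u w)\<close> with respect to \<open>u\<close>.\<close>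

lemma flux_has_derivative_0:
  fixes F :: "real^2 \<Rightarrow> real^2" and F' :: "real^2 \<Rightarrow> (real^2) \<Rightarrow>\<^sub>L (real^2)" and x w x' w' :: "real \<Rightarrow> real^2"
  assumes F: "\<And>z. z \<in> U \<Longrightarrow> (F has_derivative blinfun_apply (F' z)) (at z)" "continuous_on U F'"
    and A: "A \<subseteq> U" "\<And>z. z \<in> A \<Longrightarrow> (\<Sum>i\<in>UNIV. F' z (axis i 1) $ i) = 0"
    and S: "convex S" "t \<in> S"
    and x: "\<And>t. t \<in> S \<Longrightarrow> (x has_vector_derivative x' t) (at t)" "continuous_on S x'"
    and w: "\<And>t. t \<in> S \<Longrightarrow> (w has_vector_derivative w' t) (at t)" "continuous_on S w'"
    and segment: "\<And>t u. t \<in> S \<Longrightarrow> u \<in> {0..1} \<Longrightarrow> x t + u *\<^sub>R w t \<in> A"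
    and start: "perp (x' t) \<bullet> F (x t) = 0" and finish: "perp (x' t + w' t) \<bullet> F (x t + w t) = 0"
  shows "((\<lambda>t. integral {0..1} (\<lambda>u. perp (w t) \<bullet> F (x t + u *\<^sub>R w t))) has_real_derivative 0) (at t within S)"
proof -
  define f where "f t u = perp (w t) \<bullet> F (x t + u *\<^sub>R w t)" for t u
  define ft where "ft t u = perp (w t) \<bullet> F' (x t + u *\<^sub>R w t) (x' t + u *\<^sub>R w' t) + perp (w' t) \<bullet> F (x t + u *\<^sub>R w t)" for t u
  have Fc: "continuous_on U F" using F(1) by (meson has_derivative_continuous continuous_at_imp_continuous_on)
  have xc: "continuous_on S x" and wc: "continuous_on S w"
    using x(1) w(1) by (meson has_vector_derivative_continuous continuous_at_imp_continuous_on)+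
  have AU: "x t + u *\<^sub>R w t \<in> U" if "t \<in> S" "u \<in> {0..1}" for t u using segment that A by blast
  have perp_c: "continuous_on C (\<lambda>p. perp (g p))" if "continuous_on C g" for C :: "(real \<times> real) set" and g
    using that by (rule bounded_linear.continuous_on[OF bounded_linear_perp])
  have fx: "((\<lambda>t. f t u) has_field_derivative ft t u) (at t within S)" if "t \<in> S" "u \<in> cbox 0 1" for t u
  proof -
    have z: "((\<lambda>t. x t + u *\<^sub>R w t) has_vector_derivative x' t + u *\<^sub>R w' t) (at t)"
      using x(1)[OF that(1)] w(1)[OF that(1)] by (auto intro!: derivative_eq_intros)
    have "((\<lambda>t. F (x t + u *\<^sub>R w t)) has_vector_derivative F' (x t + u *\<^sub>R w t) (x' t + u *\<^sub>R w' t)) (at t)"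
      using vector_derivative_diff_chain_within[OF z, of F "F' (x t + u *\<^sub>R w t)"] F(1)[OF AU] that
      by (auto simp: o_def intro: has_derivative_at_withinI)
    moreover have "((\<lambda>t. perp (w t)) has_vector_derivative perp (w' t)) (at t)"
      using bounded_linear.has_vector_derivative[OF bounded_linear_perp w(1)[OF that(1)]] .
    ultimately have "((\<lambda>t. f t u) has_vector_derivative ft t u) (at t)"
      unfolding f_def ft_def by (rule bounded_bilinear.has_vector_derivative[OF bounded_bilinear_inner, rotated])
    then show ?thesis
      by (auto simp: has_real_derivative_iff_has_vector_derivative intro: has_vector_derivative_at_within)
  qed
  have z_c: "continuous_on (S \<times> cbox 0 1) (\<lambda>p. x (fst p) + snd p *\<^sub>R w (fst p))"
    by (intro continuous_intros continuous_on_compose2[OF xc] continuous_on_compose2[OF wc]) auto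
  have "continuous_on (S \<times> cbox 0 1) (\<lambda>(t, u). ft t u)"
    unfolding ft_def case_prod_unfold
    by (intro continuous_intros perp_c continuous_on_compose2[OF wc] continuous_on_compose2[OF w(2)]
        continuous_on_compose2[OF x(2)] continuous_on_compose2[OF Fc z_c] continuous_on_compose2[OF F(2) z_c])
      (use AU in auto)
  moreover have "f t integrable_on cbox 0 1" if "t \<in> S" for t
    unfolding f_def using that AU
    by (intro integrable_continuous continuous_intros continuous_on_compose2[OF Fc]) auto
  ultimately have D: "((\<lambda>t. integral (cbox 0 1) (f t)) has_field_derivative integral (cbox 0 1) (ft t)) (at t within S)"
    by (intro leibniz_rule_field_derivative fx S)
  have "(ft t has_integral (perp (x' t + 1 *\<^sub>R w' t) \<bullet> F (x t + 1 *\<^sub>R w t) - perp (x' t + 0 *\<^sub>R w' t) \<bullet> F (x t + 0 *\<^sub>R w t))) {0..1}"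
  proof (rule fundamental_theorem_of_calculus)
    fix u :: real assume u: "u \<in> {0..1}"
    let ?z = "x t + u *\<^sub>R w t" and ?z' = "x' t + u *\<^sub>R w' t"
    have z: "((\<lambda>u. x t + u *\<^sub>R w t) has_vector_derivative w t) (at u)"
      by (auto intro!: derivative_eq_intros)
    have "((\<lambda>u. F (x t + u *\<^sub>R w t)) has_vector_derivative F' ?z (w t)) (at u)"
      using vector_derivative_diff_chain_within[OF z, of F "F' ?z"] F(1)[OF AU] u S(2)
      by (auto simp: o_def intro: has_derivative_at_withinI)
    moreover have "((\<lambda>u. perp (x' t + u *\<^sub>R w' t)) has_vector_derivative perp (w' t)) (at u)"
      by (intro bounded_linear.has_vector_derivative[OF bounded_linear_perp]) (auto intro!: derivative_eq_intros)
    ultimately have "((\<lambda>u. perp (x' t + u *\<^sub>R w' t) \<bullet> F (x t + u *\<^sub>R w t)) has_vector_derivative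
        perp ?z' \<bullet> F' ?z (w t) + perp (w' t) \<bullet> F ?z) (at u)"
      by (rule bounded_bilinear.has_vector_derivative[OF bounded_bilinear_inner, rotated])
    moreover have "perp ?z' \<bullet> F' ?z (w t) + perp (w' t) \<bullet> F ?z = ft t u"
      using perp_trace_identity[of "F' ?z" "w t" ?z'] A(2)[OF segment[OF S(2) u]]
      by (simp add: ft_def blinfun.bounded_linear_right bounded_linear.linear)
    ultimately show "((\<lambda>u. perp (x' t + u *\<^sub>R w' t) \<bullet> F (x t + u *\<^sub>R w t)) has_vector_derivative ft t u) (at u within {0..1})"
      by (simp add: has_vector_derivative_at_within)
  qed simp
  \<comment> \<open>The boundary terms vanish because each end point has velocity parallel to the
    field there.\<close>
  then have "integral {0..1} (ft t) = 0" using start finish by (simp add: integral_unique)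
  then show ?thesis using D by (simp add: f_def[abs_def])
qed

subsection \<open>Expansivity of twisting flows\<close>


lemma compact_pos_lower_bound:
  fixes f :: "'a::topological_space \<Rightarrow> real"
  assumes "compact A" "continuous_on A f" "\<And>x. x \<in> A \<Longrightarrow> f x > 0"
  shows "\<exists>m>0. \<forall>x\<in>A. m \<le> f x"
proof (cases "A = {}")
  case True
  then show ?thesis by (intro exI[of _ 1]) auto
next
  case False
  then show ?thesis using continuous_attains_inf[OF assms(1) False assms(2)] assms(3) by blast
qed

text \<open>Here \<open>v\<close> and \<open>z\<close> are the values of the field at the two ends
  and the quotient is \<sigma>'. Its difference from 1 is -(Q + R) / (z . v) with \<open>Q\<close>
  linear in \<open>w\<close> and \<open>R\<close> the linearization error. As \<open>w\<close> is a
  multiple of \<open>perp v\<close>, \<open>Q\<close> is a multiple of the twisting term, so |Q| is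
  at least c |w| / M; the tolerance in \<open>lin\<close> makes |R| at most half of that, and z . v
  is at most the square of M.\<close>

lemma twisting_speed_bound:
  fixes T :: "real^2 \<Rightarrow> real^2"
  assumes T: "linear T" and v: "v \<noteq> 0" "norm v \<le> M" and z: "norm z \<le> M" "z \<bullet> v > 0"
    and w: "w \<bullet> v = 0" and c: "c > 0" "c \<le> \<bar>perp v \<bullet> T v + T (perp v) \<bullet> v\<bar>"
    and lin: "norm (z - v - T w) \<le> c / (2 * M\<^sup>2) * norm w"
  shows "c / (2 * M ^ 3) * norm w \<le> \<bar>(v \<bullet> v - w \<bullet> T v) / (z \<bullet> v) - 1\<bar>"
proof -
  have nv: "norm v > 0" using v by simp
  then have M: "M > 0" using v(2) by linarith
  define Q where "Q = w \<bullet> T v + T w \<bullet> v"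
  define R where "R = (z - v - T w) \<bullet> v"
  have nw: "(v \<bullet> v) *\<^sub>R w = (w \<bullet> perp v) *\<^sub>R perp v" using perp_decomposition[of v w] w by simp
  have "(v \<bullet> v) * Q = ((v \<bullet> v) *\<^sub>R w) \<bullet> T v + T ((v \<bullet> v) *\<^sub>R w) \<bullet> v"
    by (simp add: Q_def linear_scale[OF T] distrib_left)
  also have "\<dots> = (w \<bullet> perp v) * (perp v \<bullet> T v + T (perp v) \<bullet> v)"
    unfolding nw by (simp add: linear_scale[OF T] distrib_left)
  finally have "\<bar>v \<bullet> v\<bar> * \<bar>Q\<bar> = \<bar>w \<bullet> perp v\<bar> * \<bar>perp v \<bullet> T v + T (perp v) \<bullet> v\<bar>"
    by (metis abs_mult)
  also have "\<dots> \<ge> norm v * norm w * c"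
    unfolding abs_inner_perp_eq[OF w] using c(2) by (intro mult_left_mono) auto
  finally have "norm v * (norm w * c) \<le> norm v * (norm v * \<bar>Q\<bar>)"
    by (simp add: dot_square_norm power2_eq_square mult.assoc)
  then have "norm w * c \<le> norm v * \<bar>Q\<bar>" using nv by (rule mult_left_le_imp_le)
  also have "\<dots> \<le> M * \<bar>Q\<bar>" using v(2) by (intro mult_right_mono) auto
  finally have Q: "c / M * norm w \<le> \<bar>Q\<bar>" using M by (simp add: pos_divide_le_eq mult.commute)
  have "\<bar>R\<bar> \<le> norm (z - v - T w) * norm v" unfolding R_def by (rule Cauchy_Schwarz_ineq2)
  also have "\<dots> \<le> (c / (2 * M\<^sup>2) * norm w) * M" using lin v(2) c(1) by (intro mult_mono) auto
  also have "\<dots> = c / M * norm w / 2" using M by (simp add: power2_eq_square)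
  finally have R: "\<bar>R\<bar> \<le> c / M * norm w / 2" .
  have zv: "z \<bullet> v \<le> M\<^sup>2"
  proof -
    have "z \<bullet> v \<le> norm z * norm v" by (rule norm_cauchy_schwarz)
    also have "\<dots> \<le> M * M" using z v(2) M by (intro mult_mono) auto
    finally show ?thesis by (simp add: power2_eq_square)
  qed
  have "q / 2 \<le> \<bar>Q + R\<bar>" if "q \<le> \<bar>Q\<bar>" "\<bar>R\<bar> \<le> q / 2" for q using that by linarith
  from this[OF Q R] have QR: "c / M * norm w / 2 \<le> \<bar>Q + R\<bar>" .
  then have "(c / M * norm w / 2) / M\<^sup>2 \<le> \<bar>Q + R\<bar> / (z \<bullet> v)"
    using QR zv z(2) by (intro frac_le) auto
  also have "\<dots> = \<bar>- (Q + R) / (z \<bullet> v)\<bar>" using z(2) by (simp add: abs_divide)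
  also have "- (Q + R) / (z \<bullet> v) = (v \<bullet> v - w \<bullet> T v) / (z \<bullet> v) - 1"
  proof -
    have "- (Q + R) = (v \<bullet> v - w \<bullet> T v) - z \<bullet> v"
      by (simp add: Q_def R_def inner_diff_left)
    then show ?thesis using z(2) by (simp add: diff_divide_distrib)
  qed
  also have "(c / M * norm w / 2) / M\<^sup>2 = c / (2 * M ^ 3) * norm w"
    by (simp add: power2_eq_square power3_eq_cube)
  finally show ?thesis .
qed

text \<open>With the field frozen at \<open>x\<close> the flux is plus or minus |w| |F x|, because
  \<open>w\<close> is orthogonal to \<open>F x\<close>; the variation of \<open>F\<close> along the
  segment costs at most \<open>L\<close> times the square of |w|.\<close>

lemma flux_bounds:
  fixes F :: "real^2 \<Rightarrow> real^2"
  assumes cont: "continuous_on {0..1} (\<lambda>u. F (x + u *\<^sub>R w))"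
    and M: "\<And>u. u \<in> {0..1} \<Longrightarrow> norm (F (x + u *\<^sub>R w)) \<le> M"
    and L: "\<And>u. u \<in> {0..1} \<Longrightarrow> norm (F (x + u *\<^sub>R w) - F x) \<le> L * norm w"
    and w: "w \<bullet> F x = 0"
  shows "\<bar>integral {0..1} (\<lambda>u. perp w \<bullet> F (x + u *\<^sub>R w))\<bar> \<le> M * norm w"
    and "norm w * (norm (F x) - L * norm w) \<le> \<bar>integral {0..1} (\<lambda>u. perp w \<bullet> F (x + u *\<^sub>R w))\<bar>"
proof -
  let ?h = "\<lambda>u. perp w \<bullet> F (x + u *\<^sub>R w)"
  have hc: "continuous_on {0..1} ?h" by (intro continuous_intros cont)
  have bound: "\<bar>perp w \<bullet> b\<bar> \<le> B * norm w" if "norm b \<le> B" for b B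
  proof -
    have "\<bar>perp w \<bullet> b\<bar> \<le> norm (perp w) * norm b" by (rule Cauchy_Schwarz_ineq2)
    also have "\<dots> \<le> norm w * B" using that by (simp add: mult_left_mono)
    finally show ?thesis by (simp add: mult.commute)
  qed
  show "\<bar>integral {0..1} ?h\<bar> \<le> M * norm w"
    using integral_bound[of 0 1 ?h "M * norm w"] hc bound M by simp
  have "norm (integral {0..1} (\<lambda>u. perp w \<bullet> (F (x + u *\<^sub>R w) - F x))) \<le> L * norm w * norm w * (1 - 0)"
    by (rule integral_bound) (use bound[OF L] in \<open>auto intro!: continuous_intros cont\<close>)
  moreover have "integral {0..1} (\<lambda>u. perp w \<bullet> (F (x + u *\<^sub>R w) - F x)) = integral {0..1} ?h - perp w \<bullet> F x"
    unfolding inner_diff_right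
    by (subst integral_diff) (auto intro!: integrable_continuous_interval hc)
  ultimately have "\<bar>integral {0..1} ?h - perp w \<bullet> F x\<bar> \<le> L * norm w * norm w" by simp
  moreover have "\<bar>perp w \<bullet> F x\<bar> = norm (F x) * norm w"
  proof -
    have "perp w \<bullet> F x = - (w \<bullet> perp (F x))" by (simp add: inner_2)
    then show ?thesis using abs_inner_perp_eq[OF w] by simp
  qed
  ultimately show "norm w * (norm (F x) - L * norm w) \<le> \<bar>integral {0..1} ?h\<bar>"
    by (simp add: right_diff_distrib mult.commute mult.left_commute)
qed

lemma twisting_flow_positive_kinematic_expansive:
  fixes F :: "real^2 \<Rightarrow> real^2" and F' :: "real^2 \<Rightarrow> (real^2) \<Rightarrow>\<^sub>L (real^2)"
  assumes A: "compact A" "A \<subseteq> U" "open U"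
    and F: "\<And>x. x \<in> U \<Longrightarrow> (F has_derivative blinfun_apply (F' x)) (at x)" "continuous_on U F'"
    and trace: "\<And>x. x \<in> A \<Longrightarrow> (\<Sum>i\<in>UNIV. F' x (axis i 1) $ i) = 0"
    and nonzero: "\<And>x. x \<in> A \<Longrightarrow> F x \<noteq> 0"
    and twist: "\<And>x. x \<in> A \<Longrightarrow> perp (F x) \<bullet> F' x (F x) + F' x (perp (F x)) \<bullet> F x \<noteq> 0"
    and segment: "d1 > 0" "\<And>x z. x \<in> A \<Longrightarrow> z \<in> A \<Longrightarrow> dist x z < d1 \<Longrightarrow> (z - x) \<bullet> F x = 0 \<Longrightarrow> closed_segment x z \<subseteq> A"
    and flow: "generates_flow A F \<phi>"
  shows "positive_kinematic_expansive A \<phi>"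
proof -
  have Fc: "continuous_on U F" using F(1) by (meson has_derivative_continuous continuous_at_imp_continuous_on)
  have FcA: "continuous_on A F" and F'cA: "continuous_on A F'"
    using A(2) Fc F(2) by (auto intro: continuous_on_subset)
  obtain L where L: "L > 0" "\<And>x z. x \<in> A \<Longrightarrow> z \<in> A \<Longrightarrow> norm (F z - F x) \<le> L * norm (z - x)"
    using C1_on_compact_lipschitz[OF A F] unfolding lipschitz_on_def dist_norm by blast
  obtain m where m: "m > 0" "\<And>x. x \<in> A \<Longrightarrow> m \<le> norm (F x)"
    using compact_pos_lower_bound[OF A(1), of "\<lambda>x. norm (F x)"] FcA nonzero by (auto intro!: continuous_on_norm)
  have "bounded (F ` A)" using A(1) FcA by (intro compact_imp_bounded compact_continuous_image)
  then obtain M where M: "M > 0" "\<And>x. x \<in> A \<Longrightarrow> norm (F x) \<le> M" unfolding bounded_pos by blast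
  define N where "N x = perp (F x) \<bullet> F' x (F x) + F' x (perp (F x)) \<bullet> F x" for x
  have Nc: "continuous_on A (\<lambda>x. \<bar>N x\<bar>)" unfolding N_def
    by (intro continuous_intros bounded_linear.continuous_on[OF bounded_linear_perp] FcA F'cA)
  have Npos: "\<bar>N x\<bar> > 0" if "x \<in> A" for x using twist[OF that] by (simp add: N_def)
  obtain c where c: "c > 0" "\<And>x. x \<in> A \<Longrightarrow> c \<le> \<bar>N x\<bar>"
    using compact_pos_lower_bound[OF A(1) Nc Npos] by blast
  have c2: "c / (2 * M\<^sup>2) > 0" using c(1) M(1) by simp
  obtain d2 where d2: "d2 > 0" "\<And>x z. x \<in> A \<Longrightarrow> dist x z < d2 \<Longrightarrow>
      norm (F z - F x - F' x (z - x)) \<le> c / (2 * M\<^sup>2) * norm (z - x)"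
    using C1_uniform_linearization[OF A F c2] by blast
  \<comment> \<open>Up to distance \<kappa>, normal segments stay in \<open>A\<close>, the
    linearization estimate holds, and the field varies by at most half of its minimal length
    \<open>m\<close>.\<close>
  define \<kappa> where "\<kappa> = Min {d1 / 2, d2 / 2, m / (2 * L)}"
  have \<kappa>: "\<kappa> > 0" "\<kappa> < d1" "\<kappa> < d2" "L * \<kappa> \<le> m / 2"
  proof -
    show "\<kappa> > 0" "\<kappa> < d1" "\<kappa> < d2" using segment(1) d2(1) m(1) L(1) by (auto simp: \<kappa>_def min_less_iff_disj)
    have "L * \<kappa> \<le> L * (m / (2 * L))" using L(1) by (intro mult_left_mono) (auto simp: \<kappa>_def)
    then show "L * \<kappa> \<le> m / 2" using L(1) by simp
  qed
  have inA: "\<phi> t x \<in> A" if "x \<in> A" for t x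
    using flow that by (simp add: generates_flow_def continuous_flow_on_def)
  have deriv: "((\<lambda>t. \<phi> t x) has_vector_derivative F (\<phi> t x)) (at t)" if "x \<in> A" for t x
    using flow that by (simp add: generates_flow_def)
  have group: "\<phi> (s + t) x = \<phi> s (\<phi> t x)" "\<phi> 0 x = x" if "x \<in> A" for s t x
    using flow that by (auto simp: generates_flow_def continuous_flow_on_def)
  \<comment> \<open>The first bounds on \<eta> and \<delta> keep \<open>y s\<close> within \<kappa>
    of \<open>x t\<close> whenever \<open>\<bar>s - t\<bar> \<le> \<eta>\<close>; the bound on
    \<open>\<delta> * M\<close> ensures that \<Psi> changes sign on this time window.\<close>
  have main: "\<exists>s. y0 = \<phi> s x0 \<and> \<bar>s\<bar> < \<eta>"
    if \<eta>: "\<eta> > 0" "M * \<eta> \<le> \<kappa> / 2" and \<delta>: "\<delta> \<le> \<kappa> / 2" "\<delta> * M < m\<^sup>2 / 2 * \<eta>"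
      and x0: "x0 \<in> A" and y0: "y0 \<in> A" and close: "\<And>t. t \<ge> 0 \<Longrightarrow> dist (\<phi> t x0) (\<phi> t y0) < \<delta>"
    for \<eta> \<delta> x0 y0
  proof -
    define x where "x t = \<phi> t x0" for t
    define y where "y t = \<phi> t y0" for t
    have xA: "x t \<in> A" and yA: "y t \<in> A" for t using inA x0 y0 by (auto simp: x_def y_def)
    have xd: "(x has_vector_derivative F (x t)) (at t)" and yd: "(y has_vector_derivative F (y t)) (at t)" for t
      unfolding x_def y_def using deriv x0 y0 by auto
    have xc: "continuous_on S x" and yc: "continuous_on S y" for S
      using xd yd by (meson has_vector_derivative_continuous continuous_at_imp_continuous_on)+
    have speed: "norm (y s - y t) \<le> M * \<bar>s - t\<bar>" for s t
    proof -
      have "onorm (\<lambda>h. h *\<^sub>R F (y t)) \<le> M" for t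
        using mult_right_mono[OF M(2)[OF yA[of t]] abs_ge_zero] by (intro onorm_le) (simp add: mult.commute)
      then have "norm (y s - y t) \<le> M * norm (s - t)"
        using yd[unfolded has_vector_derivative_def]
        by (intro differentiable_bound[of UNIV y "\<lambda>t h. h *\<^sub>R F (y t)"]) auto
      then show ?thesis by simp
    qed
    have near: "norm (y s - x t) < \<kappa>" if "t \<ge> 0" "\<bar>s - t\<bar> \<le> \<eta>" for s t
    proof -
      have "norm (y s - x t) \<le> norm (y s - y t) + norm (y t - x t)"
        using norm_triangle_ineq[of "y s - y t" "y t - x t"] by simp
      also have "norm (y t - x t) < \<delta>" using close[OF that(1)] by (simp add: x_def y_def dist_norm norm_minus_commute)
      also have "norm (y s - y t) \<le> M * \<eta>"
        using speed[of s t] mult_left_mono[OF that(2), of M] M(1) by linarith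
      finally show ?thesis using \<eta> \<delta> by linarith
    qed
    have dot: "m\<^sup>2 / 2 \<le> F (y s) \<bullet> F (x t)" if "t \<ge> 0" "\<bar>s - t\<bar> \<le> \<eta>" for s t
    proof -
      have "norm (F (y s) - F (x t)) \<le> L * norm (y s - x t)" using L(2) xA yA by blast
      also have "\<dots> \<le> L * \<kappa>" using near[OF that] L(1) by (intro mult_left_mono) auto
      finally have 1: "norm (F (y s) - F (x t)) \<le> m / 2" using \<kappa>(4) by linarith
      have "m * (m / 2) \<le> norm (F (x t)) * (norm (F (x t)) - norm (F (y s) - F (x t)))"
        using m(1) m(2)[OF xA[of t]] 1 by (intro mult_mono) auto
      also have "\<dots> = F (x t) \<bullet> F (x t) - norm (F (y s) - F (x t)) * norm (F (x t))"
        by (simp add: dot_square_norm power2_eq_square algebra_simps)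
      also have "\<dots> \<le> F (x t) \<bullet> F (x t) + (F (y s) - F (x t)) \<bullet> F (x t)"
        using Cauchy_Schwarz_ineq2[of "F (y s) - F (x t)" "F (x t)"] by linarith
      also have "\<dots> = F (y s) \<bullet> F (x t)" by (simp add: inner_diff_left)
      finally show ?thesis by (simp add: power2_eq_square)
    qed
    define \<Psi> where "\<Psi> t s = (y s - x t) \<bullet> F (x t)" for t s
    have \<Psi>s: "((\<lambda>s. \<Psi> t s) has_real_derivative F (y s) \<bullet> F (x t)) (at s)" for t s
    proof -
      have "((\<lambda>s. y s - x t) has_vector_derivative F (y s)) (at s)"
        using yd by (auto intro!: derivative_eq_intros)
      from bounded_linear.has_vector_derivative[OF bounded_linear_inner_left this]
      show ?thesis unfolding \<Psi>_def by (simp add: has_real_derivative_iff_has_vector_derivative)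
    qed
    \<comment> \<open>A uniform slope of \<Psi> in \<open>s\<close>: it yields the zero \<sigma> t
      by the intermediate value theorem, and later the continuity of \<sigma>.\<close>
    have steep: "m\<^sup>2 / 2 * (s2 - s1) \<le> \<Psi> t s2 - \<Psi> t s1"
      if "t \<ge> 0" "s1 \<le> s2" "t - \<eta> \<le> s1" "s2 \<le> t + \<eta>" for t s1 s2
    proof (cases "s1 = s2")
      case False
      then have "s1 < s2" using that by simp
      then obtain z where z: "s1 < z" "z < s2" "\<Psi> t s2 - \<Psi> t s1 = (s2 - s1) * (F (y z) \<bullet> F (x t))"
        using MVT2[of s1 s2 "\<Psi> t" "\<lambda>s. F (y s) \<bullet> F (x t)"] \<Psi>s by blast
      have "m\<^sup>2 / 2 \<le> F (y z) \<bullet> F (x t)" using z that by (intro dot) auto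
      then show ?thesis using z(3) \<open>s1 < s2\<close> by (simp add: mult.commute mult_left_mono)
    qed simp
    have "\<exists>s. \<bar>s - t\<bar> < \<eta> \<and> \<Psi> t s = 0" if t: "t \<ge> 0" for t
    proof -
      have "\<bar>\<Psi> t t\<bar> \<le> norm (y t - x t) * norm (F (x t))" unfolding \<Psi>_def by (rule Cauchy_Schwarz_ineq2)
      also have "\<dots> \<le> \<delta> * M"
        using close[OF t] M(2)[OF xA[of t]] order_trans[OF zero_le_dist less_imp_le[OF close[OF t]]]
        by (intro mult_mono) (auto simp: x_def y_def dist_norm norm_minus_commute)
      finally have "\<bar>\<Psi> t t\<bar> < m\<^sup>2 / 2 * \<eta>" using \<delta>(2) by linarith
      then have sg: "\<Psi> t (t - \<eta>) < 0" "0 < \<Psi> t (t + \<eta>)"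
        using steep[OF t, of "t - \<eta>" t] steep[OF t, of t "t + \<eta>"] \<eta>(1) by auto
      have "continuous_on {t - \<eta>..t + \<eta>} (\<Psi> t)"
        using \<Psi>s by (intro continuous_at_imp_continuous_on) (auto intro: DERIV_isCont)
      then obtain s where s: "t - \<eta> \<le> s" "s \<le> t + \<eta>" "\<Psi> t s = 0"
        using IVT'[of "\<Psi> t" "t - \<eta>" 0 "t + \<eta>"] sg \<eta>(1) by auto
      then have "s \<noteq> t - \<eta>" "s \<noteq> t + \<eta>" using sg by auto
      then show ?thesis using s by (intro exI[of _ s]) auto
    qed
    then obtain \<sigma> where \<sigma>: "\<And>t. t \<ge> 0 \<Longrightarrow> \<bar>\<sigma> t - t\<bar> < \<eta>" "\<And>t. t \<ge> 0 \<Longrightarrow> \<Psi> t (\<sigma> t) = 0" by metis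
    have \<Psi>t: "isCont (\<lambda>t. \<Psi> t s) t" for s t
    proof -
      have "continuous_on UNIV (\<lambda>t. \<Psi> t s)" unfolding \<Psi>_def
        by (intro continuous_intros xc continuous_on_compose2[OF FcA xc]) (use xA in auto)
      then show ?thesis by (simp add: continuous_on_eq_continuous_at)
    qed
    have \<sigma>c: "isCont \<sigma> t" if t: "t > 0" for t
    proof -
      have "((\<lambda>t'. 2 / m\<^sup>2 * \<bar>\<Psi> t' (\<sigma> t)\<bar>) \<longlongrightarrow> 2 / m\<^sup>2 * \<bar>\<Psi> t (\<sigma> t)\<bar>) (at t)"
        using \<Psi>t[where s="\<sigma> t" and t=t] unfolding isCont_def by (intro tendsto_intros)
      then have "((\<lambda>t'. 2 / m\<^sup>2 * \<bar>\<Psi> t' (\<sigma> t)\<bar>) \<longlongrightarrow> 0) (at t)" using \<sigma>(2)[of t] t by simp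
      moreover have "\<forall>\<^sub>F t' in at t. norm (\<sigma> t' - \<sigma> t) \<le> 2 / m\<^sup>2 * \<bar>\<Psi> t' (\<sigma> t)\<bar>"
      proof -
        have "\<forall>\<^sub>F t' in at t. t' \<in> {0<..} \<inter> {\<sigma> t - \<eta><..<\<sigma> t + \<eta>}"
          using t \<sigma>(1)[of t] by (intro eventually_at_in_open') auto
        then show ?thesis
        proof (rule eventually_mono)
          fix t' assume t': "t' \<in> {0<..} \<inter> {\<sigma> t - \<eta><..<\<sigma> t + \<eta>}"
          \<comment> \<open>The slope bound at time \<open>t'\<close> is applied between
            \<open>\<sigma> t'\<close>, a zero of \<open>\<Psi> t'\<close>, and the old value
            \<open>\<sigma> t\<close>, which still lies in the window of \<open>t'\<close>.\<close>
          have "m\<^sup>2 / 2 * \<bar>\<sigma> t' - \<sigma> t\<bar> \<le> \<bar>\<Psi> t' (\<sigma> t)\<bar>"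
          proof -
            have r: "t' - \<eta> \<le> \<sigma> t'" "\<sigma> t' \<le> t' + \<eta>" "t' - \<eta> \<le> \<sigma> t" "\<sigma> t \<le> t' + \<eta>" "t' \<ge> 0"
              using \<sigma>(1)[of t'] t' by auto
            show ?thesis
            proof (cases "\<sigma> t' \<le> \<sigma> t")
              case True
              then show ?thesis using steep[OF r(5) True r(1,4)] \<sigma>(2)[OF r(5)] by simp
            next
              case False
              then have "\<sigma> t \<le> \<sigma> t'" by simp
              then show ?thesis using steep[OF r(5) _ r(3,2)] \<sigma>(2)[OF r(5)] by simp
            qed
          qed
          then have "2 / m\<^sup>2 * (m\<^sup>2 / 2 * \<bar>\<sigma> t' - \<sigma> t\<bar>) \<le> 2 / m\<^sup>2 * \<bar>\<Psi> t' (\<sigma> t)\<bar>"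
            by (rule mult_left_mono) simp
          then show "norm (\<sigma> t' - \<sigma> t) \<le> 2 / m\<^sup>2 * \<bar>\<Psi> t' (\<sigma> t)\<bar>" using m(1) by simp
        qed
      qed
      ultimately have "((\<lambda>t'. \<sigma> t' - \<sigma> t) \<longlongrightarrow> 0) (at t)" by (rule Lim_null_comparison[rotated])
      then show ?thesis unfolding isCont_def by (simp flip: Lim_null)
    qed
    \<comment> \<open>Minus the partial derivative of \<Psi> in \<open>t\<close> divided by the one
      in \<open>s\<close>, at the zero \<open>\<sigma> t\<close>.\<close>
    define \<sigma>' where "\<sigma>' t = (F (x t) \<bullet> F (x t) - (y (\<sigma> t) - x t) \<bullet> F' (x t) (F (x t))) / (F (y (\<sigma> t)) \<bullet> F (x t))" for t
    have dpos: "F (y (\<sigma> t)) \<bullet> F (x t) > 0" if "t \<ge> 0" for t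
      using dot[OF that less_imp_le[OF \<sigma>(1)[OF that]]] m(1) by (smt (verit) zero_less_power half_gt_zero)
    have \<sigma>d: "(\<sigma> has_real_derivative \<sigma>' t) (at t)" if t: "t > 0" for t
    proof -
      let ?a = "(y (\<sigma> t) - x t) \<bullet> F' (x t) (F (x t)) - F (x t) \<bullet> F (x t)" and ?b = "F (y (\<sigma> t)) \<bullet> F (x t)"
      have Fx: "((\<lambda>t. F (x t)) has_vector_derivative F' (x t) (F (x t))) (at t)"
        using vector_derivative_diff_chain_within[OF xd[of t], of F "F' (x t)"] F(1)[of "x t"] xA A(2)
        by (auto simp: o_def intro: has_derivative_at_withinI)
      have 1: "((\<lambda>p. y (snd p) - x (fst p)) has_derivative (\<lambda>h. snd h *\<^sub>R F (y (\<sigma> t)) - fst h *\<^sub>R F (x t))) (at (t, \<sigma> t))"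
        by (intro has_derivative_diff has_derivative_compose[where g=y, OF has_derivative_snd[OF has_derivative_ident], simplified]
            has_derivative_compose[where g=x, OF has_derivative_fst[OF has_derivative_ident], simplified])
          (use xd yd in \<open>auto simp: has_vector_derivative_def\<close>)
      have 2: "((\<lambda>p. F (x (fst p))) has_derivative (\<lambda>h. fst h *\<^sub>R F' (x t) (F (x t)))) (at (t, \<sigma> t))"
        by (intro has_derivative_compose[where g="\<lambda>t. F (x t)", OF has_derivative_fst[OF has_derivative_ident], simplified])
          (use Fx in \<open>auto simp: has_vector_derivative_def\<close>)
      have "((\<lambda>p. \<Psi> (fst p) (snd p)) has_derivative (\<lambda>(h, k). ?a * h + ?b * k)) (at (t, \<sigma> t))"
        unfolding \<Psi>_def
        by (rule has_derivative_eq_rhs[OF has_derivative_inner[OF 1 2]])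
          (auto simp: fun_eq_iff inner_diff_left algebra_simps)
      moreover have "\<forall>\<^sub>F s in nhds t. \<Psi> (fst (s, \<sigma> s)) (snd (s, \<sigma> s)) = 0"
        using eventually_nhds_in_open[of "{0<..}" t] t \<sigma>(2) by (auto elim!: eventually_mono)
      ultimately have "(\<sigma> has_real_derivative - ?a / ?b) (at t)"
        using dpos[of t] t by (intro implicit_has_real_derivative[OF _ _ \<sigma>c]) auto
      then show ?thesis by (simp add: \<sigma>'_def)
    qed
    define w where "w t = y (\<sigma> t) - x t" for t
    define w' where "w' t = \<sigma>' t *\<^sub>R F (y (\<sigma> t)) - F (x t)" for t
    have wx: "w t \<bullet> F (x t) = 0" "norm (w t) < \<kappa>" if "t \<ge> 0" for t
      using \<sigma>(2)[OF that] near[OF that less_imp_le[OF \<sigma>(1)[OF that]]] by (auto simp: w_def \<Psi>_def)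
    have wd: "(w has_vector_derivative w' t) (at t)" if "t > 0" for t
    proof -
      have "((y \<circ> \<sigma>) has_vector_derivative \<sigma>' t *\<^sub>R F (y (\<sigma> t))) (at t)"
        using \<sigma>d[OF that] yd by (intro vector_diff_chain_at) (auto simp: has_real_derivative_iff_has_vector_derivative)
      then show ?thesis unfolding w_def w'_def using xd by (auto simp: o_def intro: has_vector_derivative_diff)
    qed
    have seg: "x t + u *\<^sub>R w t \<in> A" if "t \<ge> 0" "u \<in> {0..1}" for t u
    proof -
      have "closed_segment (x t) (y (\<sigma> t)) \<subseteq> A"
        using wx[OF that(1)] \<kappa>(2) xA yA by (intro segment(2)) (auto simp: w_def dist_norm norm_minus_commute)
      moreover have "x t + u *\<^sub>R w t = (1 - u) *\<^sub>R x t + u *\<^sub>R y (\<sigma> t)" by (simp add: w_def algebra_simps)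
      then have "x t + u *\<^sub>R w t \<in> closed_segment (x t) (y (\<sigma> t))"
        unfolding in_segment using that(2) by auto
      ultimately show ?thesis by blast
    qed
    define h where "h t = integral {0..1} (\<lambda>u. perp (w t) \<bullet> F (x t + u *\<^sub>R w t))" for t
    have "(h has_real_derivative 0) (at t within {0<..})" if "t \<in> {0<..}" for t
      unfolding h_def
    proof (rule flux_has_derivative_0[OF F A(2) trace, where x'="\<lambda>t. F (x t)" and w'=w'])
      have yc: "continuous_on {0<..} (\<lambda>t. y (\<sigma> t))"
        using \<sigma>c by (intro continuous_on_compose2[OF yc[of UNIV] continuous_at_imp_continuous_on]) auto
      have Fxc: "continuous_on {0<..} (\<lambda>t. F (x t))" "continuous_on {0<..} (\<lambda>t. F (y (\<sigma> t)))"
        using xA yA by (auto intro!: continuous_on_compose2[OF FcA] xc yc)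
      have F'xc: "continuous_on {0<..} (\<lambda>t. F' (x t))" using xA by (auto intro!: continuous_on_compose2[OF F'cA] xc)
      have dne: "\<forall>t\<in>{0<..}. F (y (\<sigma> t)) \<bullet> F (x t) \<noteq> 0" using dpos by (metis greaterThan_iff less_imp_le less_irrefl)
      show "continuous_on {0<..} (\<lambda>t. F (x t))" by fact
      show "continuous_on {0<..} w'" unfolding w'_def \<sigma>'_def
        by (intro continuous_intros yc xc Fxc F'xc dne)
      show "perp (F (x t) + w' t) \<bullet> F (x t + w t) = 0"
        by (simp add: w'_def w_def perp_scaleR)
    qed (use that xd wd seg in auto)
    then obtain h0 where h0: "\<And>t. t > 0 \<Longrightarrow> h t = h0"
      using has_field_derivative_zero_constant[of "{0<..}" h] by auto
    have hb: "\<bar>h t\<bar> \<le> M * norm (w t)" "norm (w t) * (m / 2) \<le> \<bar>h t\<bar>" if t: "t \<ge> 0" for t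
    proof -
      have cont: "continuous_on {0..1} (\<lambda>u. F (x t + u *\<^sub>R w t))"
        by (intro continuous_on_compose2[OF FcA] continuous_intros) (use seg[OF t] in auto)
      have Lw: "norm (F (x t + u *\<^sub>R w t) - F (x t)) \<le> L * norm (w t)" if "u \<in> {0..1}" for u
      proof -
        have "norm (F (x t + u *\<^sub>R w t) - F (x t)) \<le> L * norm (x t + u *\<^sub>R w t - x t)"
          using seg[OF t that] xA by (rule L(2)[rotated])
        also have "\<dots> \<le> L * norm (w t)"
          using that L(1) mult_right_mono[of u 1 "norm (w t)"] by (intro mult_left_mono) auto
        finally show ?thesis .
      qed
      note fb = flux_bounds[of F "x t" "w t" M L, OF cont M(2)[OF seg[OF t]] Lw wx(1)[OF t], folded h_def]
      show "\<bar>h t\<bar> \<le> M * norm (w t)" by (rule fb(1))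
      have "L * norm (w t) \<le> L * \<kappa>" using wx(2)[OF t] L(1) by (intro mult_left_mono) auto
      then have "m / 2 \<le> norm (F (x t)) - L * norm (w t)" using \<kappa>(4) m(2)[OF xA[of t]] by linarith
      then have "norm (w t) * (m / 2) \<le> norm (w t) * (norm (F (x t)) - L * norm (w t))" by (rule mult_left_mono) simp
      then show "norm (w t) * (m / 2) \<le> \<bar>h t\<bar>" using fb(2) by linarith
    qed
    have drift: "c / (2 * M ^ 3) * norm (w t) \<le> \<bar>\<sigma>' t - 1\<bar>" if t: "t \<ge> 0" for t
      unfolding \<sigma>'_def w_def[symmetric]
    proof (rule twisting_speed_bound)
      show "linear (F' (x t))" by (simp add: blinfun.bounded_linear_right bounded_linear.linear)
      have "dist (x t) (y (\<sigma> t)) < d2" using wx(2)[OF t] \<kappa>(3) by (simp add: w_def dist_norm norm_minus_commute)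
      then show "norm (F (y (\<sigma> t)) - F (x t) - F' (x t) (w t)) \<le> c / (2 * M\<^sup>2) * norm (w t)"
        unfolding w_def by (rule d2(2)[OF xA])
    qed (use nonzero M c[unfolded N_def] xA yA dpos[OF t] wx(1)[OF t] in auto)
    have "h0 = 0"
    proof (rule ccontr)
      assume "h0 \<noteq> 0"
      define k where "k = c / (2 * M ^ 3) * (\<bar>h0\<bar> / M)"
      have k: "k > 0" using \<open>h0 \<noteq> 0\<close> c(1) M(1) by (simp add: k_def)
      have fast: "k \<le> \<bar>\<sigma>' t - 1\<bar>" if "t > 0" for t
      proof -
        have "\<bar>h0\<bar> / M \<le> norm (w t)" using hb(1)[of t] h0[OF that] that M(1) by (simp add: pos_divide_le_eq mult.commute)
        then have "k \<le> c / (2 * M ^ 3) * norm (w t)" unfolding k_def using c(1) M(1) by (intro mult_left_mono) auto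
        then show ?thesis using drift[of t] that by simp
      qed
      \<comment> \<open>Over the interval from 1 to \<open>T\<close> a speed difference of at least
        \<open>k\<close> accumulates a drift of at least \<open>2 * \<eta> + 1\<close>, while
        \<open>\<sigma> t - t\<close> can change by less than \<open>2 * \<eta>\<close>.\<close>
      define T where "T = 1 + (2 * \<eta> + 1) / k"
      have T: "T > 1" using k \<eta>(1) by (simp add: T_def)
      have "\<exists>z. 1 < z \<and> z < T \<and> (\<sigma> T - T) - (\<sigma> 1 - 1) = (T - 1) * (\<sigma>' z - 1)"
        using T by (intro MVT2) (auto intro!: derivative_eq_intros \<sigma>d)
      then obtain z where z: "1 < z" "(\<sigma> T - T) - (\<sigma> 1 - 1) = (T - 1) * (\<sigma>' z - 1)" by blast
      have "2 * \<eta> + 1 = (T - 1) * k" using k by (simp add: T_def)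
      also have "\<dots> \<le> (T - 1) * \<bar>\<sigma>' z - 1\<bar>" using fast[of z] z(1) T by (intro mult_left_mono) auto
      also have "\<dots> = \<bar>(\<sigma> T - T) - (\<sigma> 1 - 1)\<bar>" using T by (simp add: z(2) abs_mult)
      also have "\<dots> < 2 * \<eta>" using \<sigma>(1)[of T] \<sigma>(1)[of 1] T by linarith
      finally show False by simp
    qed
    \<comment> \<open>Zero flux forces \<open>w\<close> to vanish by the lower flux bound. Any
      positive time would do; at time 1 the orbits meet with shift \<open>1 - \<sigma> 1\<close>,
      which is smaller than \<eta>.\<close>
    then have "w 1 = 0" using hb(2)[of 1] h0[of 1] m(1) by (simp add: mult_le_0_iff)
    then have eq: "\<phi> (\<sigma> 1) y0 = \<phi> 1 x0" by (simp add: w_def x_def y_def)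
    have "y0 = \<phi> (- \<sigma> 1) (\<phi> (\<sigma> 1) y0)" using group(1)[OF y0, of "- \<sigma> 1" "\<sigma> 1"] by (simp add: group(2)[OF y0])
    also have "\<dots> = \<phi> (- \<sigma> 1 + 1) x0" unfolding eq using group(1)[OF x0, of "- \<sigma> 1" 1] by simp
    finally show ?thesis using \<sigma>(1)[of 1] by (intro exI[of _ "- \<sigma> 1 + 1"]) auto
  qed
  show ?thesis
    unfolding positive_kinematic_expansive_def
  proof (intro allI impI)
    fix \<epsilon> :: real assume \<epsilon>: "\<epsilon> > 0"
    define \<eta> where "\<eta> = min \<epsilon> (\<kappa> / (2 * M))"
    have \<eta>: "\<eta> > 0" "\<eta> \<le> \<epsilon>" using \<epsilon> \<kappa>(1) M(1) by (auto simp: \<eta>_def)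
    have "M * \<eta> \<le> M * (\<kappa> / (2 * M))" using M(1) by (intro mult_left_mono) (auto simp: \<eta>_def)
    then have \<eta>': "M * \<eta> \<le> \<kappa> / 2" using M(1) by simp
    define \<delta> where "\<delta> = min (\<kappa> / 2) (m\<^sup>2 / 4 * \<eta> / M)"
    have \<delta>: "\<delta> > 0" "\<delta> \<le> \<kappa> / 2" using \<kappa>(1) m(1) \<eta>(1) M(1) by (auto simp: \<delta>_def)
    have "\<delta> * M \<le> (m\<^sup>2 / 4 * \<eta> / M) * M" using M(1) by (intro mult_right_mono) (auto simp: \<delta>_def)
    also have "\<dots> < m\<^sup>2 / 2 * \<eta>" using M(1) m(1) \<eta>(1) by simp
    finally have \<delta>': "\<delta> * M < m\<^sup>2 / 2 * \<eta>" .
    show "\<exists>\<delta>>0. \<forall>x\<in>A. \<forall>y\<in>A. (\<forall>t\<ge>0. dist (\<phi> t x) (\<phi> t y) < \<delta>) \<longrightarrow> (\<exists>s. y = \<phi> s x \<and> \<bar>s\<bar> < \<epsilon>)"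
    proof (rule exI[of _ \<delta>], intro conjI ballI impI)
      fix x y assume "x \<in> A" "y \<in> A" "\<forall>t\<ge>0. dist (\<phi> t x) (\<phi> t y) < \<delta>"
      then have "\<exists>s. y = \<phi> s x \<and> \<bar>s\<bar> < \<eta>" by (intro main[OF \<eta>(1) \<eta>' \<delta>(2) \<delta>']) auto
      then show "\<exists>s. y = \<phi> s x \<and> \<bar>s\<bar> < \<epsilon>" using \<eta>(2) by fastforce
    qed (rule \<delta>(1))
  qed
qed

subsection \<open>Robustness\<close>


lemma C1_on_extension:
  assumes "C1_annulus A" "C1_on A Y"
  shows "\<exists>U F (F' :: real^2 \<Rightarrow> (real^2) \<Rightarrow>\<^sub>L (real^2)). open U \<and> A \<subseteq> U \<and> (\<forall>x\<in>A. F x = Y x) \<and>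
    (\<forall>x\<in>U. (F has_derivative blinfun_apply (F' x)) (at x)) \<and> continuous_on U F' \<and>
    (\<forall>x\<in>A. (Y has_derivative blinfun_apply (F' x)) (at x within A))"
proof -
  obtain U F and F' :: "real^2 \<Rightarrow> (real^2) \<Rightarrow>\<^sub>L (real^2)"
    where F: "open U" "A \<subseteq> U" "\<forall>x\<in>A. F x = Y x"
      "\<forall>x\<in>U. (F has_derivative blinfun_apply (F' x)) (at x)" "continuous_on U F'"
    using assms(2) unfolding C1_on_def by blast
  have "(Y has_derivative blinfun_apply (F' x)) (at x within A)" if "x \<in> A" for x
  proof (rule has_derivative_transform[OF that])
    show "(F has_derivative blinfun_apply (F' x)) (at x within A)"
      using F(2,4) that by (blast intro: has_derivative_at_withinI)
  qed (use F(3) in auto)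
  with F show ?thesis by blast
qed

text \<open>\<open>frechet_derivative\<close> merely chooses a derivative; uniqueness within
  \<open>A\<close>, boundary included, identifies the choice. Hence \<open>divergence\<close> and
  \<open>C1_close\<close> can be evaluated with the derivative of any C1 extension.\<close>

lemma C1_annulus_frechet_derivative:
  assumes "C1_annulus A" "x \<in> A" "(f has_derivative D) (at x within A)"
  shows "frechet_derivative f (at x within A) = D"
proof -
  have "(f has_derivative frechet_derivative f (at x within A)) (at x within A)"
    using assms(3) by (meson differentiable_def frechet_derivative_works)
  then show ?thesis
    using C1_annulus_structure(2,3)[OF assms(1)] assms(2,3)
    by (intro derivative_within_unique[of A x f]) blast+
qed

text \<open>The summands are diagonal entries of the derivative of \<open>perp v\<close> divided by
  the squared length of \<open>v\<close>, composed with \<open>T\<close>. What remains is a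
  polynomial identity modulo the relation that \<open>k\<close> inverts
  \<open>v \<bullet> v\<close>.\<close>

lemma sum_normalized_perp:
  fixes T :: "real^2 \<Rightarrow> real^2"
  assumes T: "linear T" and v: "v \<noteq> 0"
  shows "(v \<bullet> v)\<^sup>2 * (\<Sum>i\<in>UNIV. (inverse (v \<bullet> v) *\<^sub>R perp (T (axis i 1))
      + (- (inverse (v \<bullet> v) * (2 * (v \<bullet> T (axis i 1))) * inverse (v \<bullet> v))) *\<^sub>R perp v) $ i)
    = - (perp v \<bullet> T v + T (perp v) \<bullet> v)"
proof -
  define a b k p q where "a = T (axis 1 1)" and "b = T (axis 2 1)" and "k = inverse (v \<bullet> v)"
    and "p = v $ 1" and "q = v $ 2"
  have Tv: "T v = v $ 1 *\<^sub>R a + v $ 2 *\<^sub>R b" "T (perp v) = perp v $ 1 *\<^sub>R a + perp v $ 2 *\<^sub>R b"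
    unfolding a_def b_def by (rule linear_real2[OF T])+
  have "(v \<bullet> v) * k = 1" using v by (simp add: k_def)
  then have k: "(p * p + q * q) * k = 1" by (simp add: inner_2 p_def q_def)
  have "(p * p + q * q)\<^sup>2 * (k * - (a $ 2) + - (k * (2 * (p * a $ 1 + q * a $ 2)) * k) * - q
      + (k * b $ 1 + - (k * (2 * (p * b $ 1 + q * b $ 2)) * k) * p))
    = - ((- q) * (p * a $ 1 + q * b $ 1) + p * (p * a $ 2 + q * b $ 2)
      + ((- q * a $ 1 + p * b $ 1) * p + (- q * a $ 2 + p * b $ 2) * q))"
    using k by algebra
  then show ?thesis
    unfolding sum_2 a_def[symmetric] b_def[symmetric] k_def[symmetric] Tv
    by (simp add: inner_2 p_def q_def)
qed

lemma divergence_normalized_perp: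
  assumes A: "C1_annulus A" "x \<in> A" and X: "(X has_derivative T) (at x within A)" "X x \<noteq> 0"
  shows "((X x \<bullet> X x)\<^sup>2) * divergence A (\<lambda>x. perp (X x) /\<^sub>R (norm (X x))\<^sup>2) x
    = - (perp (X x) \<bullet> T (X x) + T (perp (X x)) \<bullet> X x)"
proof -
  have T: "linear T" using X(1) by (rule has_derivative_linear)
  let ?n = "X x \<bullet> X x"
  have n: "?n \<noteq> 0" using X(2) by simp
  have dn: "((\<lambda>x. X x \<bullet> X x) has_derivative (\<lambda>h. 2 * (X x \<bullet> T h))) (at x within A)"
    using has_derivative_inner[OF X(1) X(1)] by (rule has_derivative_eq_rhs) (simp add: fun_eq_iff inner_commute)
  have dp: "((\<lambda>x. perp (X x)) has_derivative (\<lambda>h. perp (T h))) (at x within A)"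
    by (rule bounded_linear.has_derivative[OF bounded_linear_perp X(1)])
  have "((\<lambda>x. inverse (X x \<bullet> X x) *\<^sub>R perp (X x)) has_derivative
      (\<lambda>h. inverse ?n *\<^sub>R perp (T h) + (- (inverse ?n * (2 * (X x \<bullet> T h)) * inverse ?n)) *\<^sub>R perp (X x))) (at x within A)"
    by (rule has_derivative_scaleR[OF Deriv.has_derivative_inverse[OF n dn] dp])
  then have dZ: "((\<lambda>x. perp (X x) /\<^sub>R (norm (X x))\<^sup>2) has_derivative
      (\<lambda>h. inverse ?n *\<^sub>R perp (T h) + (- (inverse ?n * (2 * (X x \<bullet> T h)) * inverse ?n)) *\<^sub>R perp (X x))) (at x within A)"
    by (simp only: power2_norm_eq_inner)
  show ?thesis
    unfolding divergence_def C1_annulus_frechet_derivative[OF A dZ] by (rule sum_normalized_perp[OF T X(2)])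
qed

lemma C1_field_positive_kinematic_expansive:
  assumes A: "C1_annulus A" and Y: "Y \<in> C1_div_free_fields A"
    and nonzero: "\<And>x. x \<in> A \<Longrightarrow> Y x \<noteq> 0"
    and twist: "\<And>x T. x \<in> A \<Longrightarrow> (Y has_derivative T) (at x within A) \<Longrightarrow>
      perp (Y x) \<bullet> T (Y x) + T (perp (Y x)) \<bullet> Y x \<noteq> 0"
  shows "\<exists>\<phi>. generates_flow A Y \<phi> \<and> positive_kinematic_expansive A \<phi>"
proof -
  note str = C1_annulus_structure[OF A]
  have Y': "C1_on A Y" "\<And>x. x \<in> A \<Longrightarrow> divergence A Y x = 0"
    "\<And>p. p \<in> frontier A \<Longrightarrow> tangent_vector (frontier A) p (Y p)"
    using Y by (auto simp: C1_div_free_fields_def)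
  obtain U F and F' :: "real^2 \<Rightarrow> (real^2) \<Rightarrow>\<^sub>L (real^2)"
    where U: "open U" "A \<subseteq> U" and FY: "\<And>x. x \<in> A \<Longrightarrow> F x = Y x"
      and F: "\<And>x. x \<in> U \<Longrightarrow> (F has_derivative blinfun_apply (F' x)) (at x)" "continuous_on U F'"
      and Yd: "\<And>x. x \<in> A \<Longrightarrow> (Y has_derivative blinfun_apply (F' x)) (at x within A)"
    using C1_on_extension[OF A Y'(1)] by blast
  have Yc: "continuous_on A Y" using Yd by (meson has_derivative_continuous continuous_on_eq_continuous_within)
  have clA: "closed A" using str(1) by (rule compact_imp_closed)
  have fA: "frontier A \<subseteq> A" using clA by (rule frontier_subset_closed)
  obtain L where "L-lipschitz_on A F" using C1_on_compact_lipschitz[OF str(1) U(2,1) F] by blast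
  then have "L-lipschitz_on A Y" by (rule lipschitz_on_transform) (simp add: FY)
  then obtain \<phi> where \<phi>: "generates_flow A Y \<phi>"
    using lipschitz_tangent_field_generates_flow[OF clA _ Y'(3)] by blast
  have flat: "chords_parallel_at (frontier A) p (Y p)" if "p \<in> frontier A" for p
    using str(3)[OF that] tangent_vector_chords_parallel Y'(3)[OF that] nonzero fA that by blast
  obtain d where d: "d > 0"
    "\<And>x z. x \<in> A \<Longrightarrow> z \<in> A \<Longrightarrow> dist x z < d \<Longrightarrow> (z - x) \<bullet> Y x = 0 \<Longrightarrow> closed_segment x z \<subseteq> A"
    using transversal_segment_subset[OF str(1) Yc flat] by blast
  have inA: "\<phi> t x \<in> A" if "x \<in> A" for t x
    using \<phi> that by (simp add: generates_flow_def continuous_flow_on_def)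
  \<comment> \<open>Off \<open>A\<close> the values of \<open>Y\<close> are arbitrary, so the
    analysis is carried out for the extension \<open>F\<close>; orbits stay in \<open>A\<close>, so
    both fields have the same flow.\<close>
  have "generates_flow A F \<phi>" using \<phi> inA FY unfolding generates_flow_def by simp
  then have "positive_kinematic_expansive A \<phi>"
  proof (rule twisting_flow_positive_kinematic_expansive[OF str(1) U(2,1) F _ _ _ d(1), rotated -1])
    show "(\<Sum>i\<in>UNIV. F' x (axis i 1) $ i) = 0" if "x \<in> A" for x
      using Y'(2)[OF that] unfolding divergence_def C1_annulus_frechet_derivative[OF A that Yd[OF that]] .
    show "perp (F x) \<bullet> F' x (F x) + F' x (perp (F x)) \<bullet> F x \<noteq> 0" if "x \<in> A" for x
      using twist[OF that Yd[OF that]] FY[OF that] by simp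
  qed (use nonzero FY d(2) in auto)
  with \<phi> show ?thesis by blast
qed

theorem theorem7p2:
  fixes A :: "(real^2) set" and X Z :: "real^2 \<Rightarrow> real^2"
  assumes "C1_annulus A"
    and "X \<in> C1_div_free_fields A"
    and "\<forall>x\<in>A. X x \<noteq> 0"
    and "Z = (\<lambda>x. perp (X x) /\<^sub>R (norm (X x))\<^sup>2)"
    and "\<forall>x\<in>A. divergence A Z x \<noteq> 0"
  shows "robustly_positive_kinematic_expansive A X"
proof -
  note A = assms(1)
  have cA: "compact A" by (rule C1_annulus_structure(1)[OF A])
  obtain U F and F' :: "real^2 \<Rightarrow> (real^2) \<Rightarrow>\<^sub>L (real^2)"
    where U: "A \<subseteq> U" "continuous_on U F'"
      and Xd: "\<And>x. x \<in> A \<Longrightarrow> (X has_derivative blinfun_apply (F' x)) (at x within A)"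
    using C1_on_extension[OF A, of X] assms(2) unfolding C1_div_free_fields_def by blast
  have Xc: "continuous_on A X" using Xd by (meson has_derivative_continuous continuous_on_eq_continuous_within)
  \<comment> \<open>The twisting term as a polynomial, hence continuous, function of a pair
    consisting of a value and a derivative; robustness thus becomes an openness statement about such
    pairs.\<close>
  define N where "N p = perp (fst p) \<bullet> blinfun_apply (snd p) (fst p) + blinfun_apply (snd p) (perp (fst p)) \<bullet> fst p"
    for p :: "(real^2) \<times> ((real^2) \<Rightarrow>\<^sub>L (real^2))"
  have Nc: "continuous_on S N" for S
    unfolding N_def by (intro continuous_intros bounded_linear.continuous_on[OF bounded_linear_perp])
  have NX: "N (X x, F' x) \<noteq> 0" if "x \<in> A" for x
  proof
    assume "N (X x, F' x) = 0"
    moreover have "X x \<noteq> 0" using assms(3) that by blast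
    ultimately have "(X x \<bullet> X x)\<^sup>2 * divergence A Z x = 0"
      using divergence_normalized_perp[OF A that Xd[OF that]] unfolding assms(4) by (simp add: N_def)
    then show False using \<open>X x \<noteq> 0\<close> assms(5) that by simp
  qed
  define S where "S = (\<lambda>x. (X x, F' x)) ` A"
  \<comment> \<open>The closed set of bad pairs, disjoint from the compact set \<open>S\<close> of
    pairs realized by \<open>X\<close>. Their distance \<open>d\<close> is halved below because
    \<open>C1_close\<close> bounds value and derivative separately and the norm of a pair is at most
    the sum.\<close>
  define C where "C = {p. fst p = 0 \<or> N p = 0}"
  have "compact S" unfolding S_def
    by (intro compact_continuous_image continuous_intros Xc continuous_on_subset[OF U(2)] U(1) cA)
  moreover have "closed C" unfolding C_def
    by (intro closed_Collect_disj closed_Collect_eq continuous_intros Nc)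
  moreover have "S \<inter> C = {}" using assms(3) NX by (auto simp: S_def C_def)
  ultimately obtain d where d: "d > 0" "\<And>p q. p \<in> S \<Longrightarrow> q \<in> C \<Longrightarrow> d \<le> dist p q"
    using separate_compact_closed by metis
  show ?thesis
    unfolding robustly_positive_kinematic_expansive_def
  proof (intro exI[of _ "d / 2"] conjI ballI impI)
    show "d / 2 > 0" using d(1) by simp
    fix Y assume Y: "Y \<in> C1_div_free_fields A" and close: "C1_close A (d / 2) X Y"
    have good: "(Y x, T) \<notin> C" if x: "x \<in> A" and T: "(Y has_derivative blinfun_apply T) (at x within A)" for x T
    proof
      assume "(Y x, T) \<in> C"
      then have "d \<le> dist (X x, F' x) (Y x, T)" using x by (intro d(2)) (auto simp: S_def)
      also have "\<dots> = norm (X x - Y x, F' x - T)" by (simp add: dist_norm)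
      also have "\<dots> \<le> norm (X x - Y x) + norm (F' x - T)" by (rule norm_Pair_le)
      also have "norm (F' x - T) = onorm (\<lambda>v. T v - F' x v)"
        by (subst norm_minus_commute) (simp add: norm_blinfun.rep_eq minus_blinfun.rep_eq)
      also have "\<dots> < d / 2"
        using close x C1_annulus_frechet_derivative[OF A x T] C1_annulus_frechet_derivative[OF A x Xd[OF x]]
        by (auto simp: C1_close_def)
      also have "norm (X x - Y x) < d / 2" using close x by (auto simp: C1_close_def norm_minus_commute)
      finally show False by simp
    qed
    have Y1: "C1_on A Y" using Y by (simp add: C1_div_free_fields_def)
    show "\<exists>\<phi>. generates_flow A Y \<phi> \<and> positive_kinematic_expansive A \<phi>"
    proof (rule C1_field_positive_kinematic_expansive[OF A Y])
      fix x assume x: "x \<in> A"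
      obtain T where T: "(Y has_derivative blinfun_apply T) (at x within A)"
        using C1_on_extension[OF A Y1] x by blast
      show "Y x \<noteq> 0" using good[OF x T] by (simp add: C_def)
    next
      fix x T assume x: "x \<in> A" and T: "(Y has_derivative T) (at x within A)"
      have "blinfun_apply (Blinfun T) = T"
        using T by (intro bounded_linear_Blinfun_apply has_derivative_bounded_linear)
      then show "perp (Y x) \<bullet> T (Y x) + T (perp (Y x)) \<bullet> Y x \<noteq> 0"
        using good[OF x, of "Blinfun T"] T by (simp add: C_def N_def)
    qed
  qed
qed

end
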